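(* Let $(\mathcal{L},H,G)$ be the 4-dimensional almost hypercomplex manifold with Hermitian-Norden metrics constructed (as described in the context) on a simply connected 4-dimensional real Lie group $\mathcal{L}$ whose Lie algebra $\mathfrak{l}$ is one of $\mathfrak{g}_{4,1},\dots,\mathfrak{g}_{4,12}$, with the structure defined with respect to the basis $\{e_1,e_2,e_3,e_4\}$ in which the brackets of $\mathfrak{g}_{4,i}$ are listed. Write $\mathcal{W}_{ij}=\mathcal{W}_i\oplus\mathcal{W}_j$ and $\mathcal{W}_{ijk}=\mathcal{W}_i\oplus\mathcal{W}_j\oplus\mathcal{W}_k$. Then $(\mathcal{L},H,G)$ belongs to the following classes with respect to $J_1$; $J_2$; $J_3$ (in this order): $\mathfrak{g}_{4,1}$: $\mathcal{W}_{24}$; $\mathcal{W}_{123}$; $\mathcal{W}_{123}$. $\mathfrak{g}_{4,2}$, $m=1$: $\mathcal{W}_{4}$; $\mathcal{W}_{123}$; $\mathcal{W}_{123}$. $\mathfrak{g}_{4,2}$, $m\neq0$, $m\neq 1$: $\mathcal{W}_{24}$; $\mathcal{W}_{123}$; $\mathcal{W}_{123}$. $\mathfrak{g}_{4,3}$: $\mathcal{W}_{24}$; $\mathcal{W}_{123}$; $\mathcal{W}_{123}$. $\mathfrak{g}_{4,4}$: $\mathcal{W}_{24}$; $\mathcal{W}_{123}$; $\mathcal{W}_{123}$. $\mathfrak{g}_{4,5}$, $a_1=-1$, $a_2=1$: $\mathcal{W}_{2}$; $\mathcal{W}_{2}$; $\mathcal{W}_{123}$. $\mathfrak{g}_{4,5}$,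 $a_1=-1$, $a_2=-1$: $\mathcal{W}_{2}$; $\mathcal{W}_{123}$; $\mathcal{W}_{2}$. $\mathfrak{g}_{4,5}$, $a_1=-1$, $a_2\neq\pm1$: $\mathcal{W}_{2}$; $\mathcal{W}_{123}$; $\mathcal{W}_{123}$. $\mathfrak{g}_{4,5}$, $a_1=1$, $a_2=1$: $\mathcal{W}_{4}$; $\mathcal{W}_{1}$; $\mathcal{W}_{12}$. $\mathfrak{g}_{4,5}$, $a_1=1$, $a_2=-3$: $\mathcal{W}_{4}$; $\mathcal{W}_{23}$; $\mathcal{W}_{23}$. $\mathfrak{g}_{4,5}$, $a_1=1$, $a_2\notin\{-3,1\}$: $\mathcal{W}_{4}$; $\mathcal{W}_{123}$; $\mathcal{W}_{123}$. $\mathfrak{g}_{4,5}$, $a_1\neq\pm1$, $a_2=1$: $\mathcal{W}_{24}$; $\mathcal{W}_{12}$; $\mathcal{W}_{123}$. $\mathfrak{g}_{4,5}$, $a_1=-\frac13$, $a_2=-\frac13$: $\mathcal{W}_{24}$; $\mathcal{W}_{23}$; $\mathcal{W}_{12}$. $\mathfrak{g}_{4,5}$, $a_1=-\frac12(a_2+1)$, $a_2\notin\{-3,-\frac13,1\}$: $\mathcal{W}_{24}$; $\mathcal{W}_{23}$; $\mathcal{W}_{123}$. $\mathfrak{g}_{4,5}$, $a_1=a_2$, $a_2\notin\{1,-1,-\frac13\}$: $\mathcal{W}_{24}$; $\mathcal{W}_{123}$; $\mathcal{W}_{12}$. $\mathfrak{g}_{4,5}$, $a_1=-a_2-2$, $a_2\notin\{-3,-1\}$: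 $\mathcal{W}_{24}$; $\mathcal{W}_{123}$; $\mathcal{W}_{23}$. $\mathfrak{g}_{4,5}$, $a_1\neq0$, $a_2\neq0$: $\mathcal{W}_{24}$; $\mathcal{W}_{123}$; $\mathcal{W}_{123}$. $\mathfrak{g}_{4,6}$, $b_1\neq0$, $b_2\geq0$: $\mathcal{W}_{24}$; $\mathcal{W}_{123}$; $\mathcal{W}_{12}$. $\mathfrak{g}_{4,7}$: $\mathcal{W}_{4}$; $\mathcal{W}_{123}$; $\mathcal{W}_{123}$. $\mathfrak{g}_{4,8}$: $\mathcal{W}_{24}$; $\mathcal{W}_{123}$; $\mathcal{W}_{3}$. $\mathfrak{g}_{4,9}$, $p=1$: $\mathcal{W}_{4}$; $\mathcal{W}_{12}$; $\mathcal{W}_{12}$. $\mathfrak{g}_{4,9}$, $-1<p<1$: $\mathcal{W}_{24}$; $\mathcal{W}_{12}$; $\mathcal{W}_{123}$. $\mathfrak{g}_{4,10}$: $\mathcal{W}_{24}$; $\mathcal{W}_{123}$; $\mathcal{W}_{123}$. $\mathfrak{g}_{4,11}$, $q>0$: $\mathcal{W}_{24}$; $\mathcal{W}_{123}$; $\mathcal{W}_{12}$. $\mathfrak{g}_{4,12}$: $\mathcal{W}_{4}$; $\mathcal{W}_{123}$; $\mathcal{W}_{123}$. Moreover: (i) if $\mathfrak{l}=\mathfrak{g}_{4,5}$, then for each $a_1\neq0$ and $a_2\neq0$, $(\mathcal{L},H,G)$ does not belong to any of: $\mathcal{W}_0$ for $J_1$; $\mathcal{W}_0$, $\mathcal{W}_3$,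 $\mathcal{W}_{13}$ for $J_2$; $\mathcal{W}_0$, $\mathcal{W}_1$, $\mathcal{W}_3$, $\mathcal{W}_{13}$ for $J_3$; (ii) if $\mathfrak{l}=\mathfrak{g}_{4,6}$, then for each $b_1\neq0$, $b_2\geq0$, $(\mathcal{L},H,G)$ does not belong to any of: $\mathcal{W}_0$, $\mathcal{W}_2$, $\mathcal{W}_4$ for $J_1$; $\mathcal{W}_0$, $\mathcal{W}_1$, $\mathcal{W}_2$, $\mathcal{W}_3$, $\mathcal{W}_{12}$, $\mathcal{W}_{13}$, $\mathcal{W}_{23}$ for $J_2$; $\mathcal{W}_0$, $\mathcal{W}_1$, $\mathcal{W}_2$ for $J_3$; (iii) if $\mathfrak{l}=\mathfrak{g}_{4,2}$, then for each $m\neq0$, $(\mathcal{L},H,G)$ does not belong to any of: $\mathcal{W}_0$, $\mathcal{W}_2$ for $J_1$; $\mathcal{W}_0$, $\mathcal{W}_1$, $\mathcal{W}_2$, $\mathcal{W}_3$, $\mathcal{W}_{12}$, $\mathcal{W}_{13}$, $\mathcal{W}_{23}$ for $J_2$; $\mathcal{W}_0$, $\mathcal{W}_1$, $\mathcal{W}_2$, $\mathcal{W}_3$, $\mathcal{W}_{12}$, $\mathcal{W}_{13}$, $\mathcal{W}_{23}$ for $J_3$; (iv) if $\mathfrak{l}=\mathfrak{g}_{4,9}$, then for each $-1<p\leq1$, $(\mathcal{L},H,G)$ does not belong to any of: $\mathcal{W}_0$, $\mathcal{W}_2$ for $J_1$; $\mathcal{W}_0$, $\mathcal{W}_1$, $\mathcal{W}_2$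 for $J_2$; $\mathcal{W}_0$, $\mathcal{W}_1$, $\mathcal{W}_2$, $\mathcal{W}_3$, $\mathcal{W}_{13}$, $\mathcal{W}_{23}$ for $J_3$; (v) if $\mathfrak{l}=\mathfrak{g}_{4,11}$, then for each $q>0$, $(\mathcal{L},H,G)$ does not belong to any of: $\mathcal{W}_0$, $\mathcal{W}_2$, $\mathcal{W}_4$ for $J_1$; $\mathcal{W}_0$, $\mathcal{W}_1$, $\mathcal{W}_2$, $\mathcal{W}_3$, $\mathcal{W}_{12}$, $\mathcal{W}_{13}$, $\mathcal{W}_{23}$ for $J_2$; $\mathcal{W}_0$, $\mathcal{W}_1$, $\mathcal{W}_2$ for $J_3$.
   Context: **Lie algebras.** Each $\mathfrak{g}_{4,i}$ is the real Lie algebra with basis $\{e_1,e_2,e_3,e_4\}$ whose non-zero brackets are (up to antisymmetry), with real parameters: $\mathfrak{g}_{4,1}$: $[e_2,e_4]=e_1$, $[e_3,e_4]=e_2$; $\mathfrak{g}_{4,2}$: $[e_1,e_4]=m e_1$, $[e_2,e_4]=e_2$, $[e_3,e_4]=e_2+e_3$ ($m\neq0$); $\mathfrak{g}_{4,3}$: $[e_1,e_4]=e_1$, $[e_3,e_4]=e_2$; $\mathfrak{g}_{4,4}$: $[e_1,e_4]=e_1$, $[e_2,e_4]=e_1+e_2$, $[e_3,e_4]=e_2+e_3$; $\mathfrak{g}_{4,5}$: $[e_1,e_4]=e_1$, $[e_2,e_4]=a_1e_2$, $[e_3,e_4]=a_2e_3$ ($a_1\neq0$, $a_2\neq0$); $\mathfrak{g}_{4,6}$: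 $[e_1,e_4]=b_1e_1$, $[e_2,e_4]=b_2e_2-e_3$, $[e_3,e_4]=e_2+b_2e_3$ ($b_1\neq0$, $b_2\geq0$); $\mathfrak{g}_{4,7}$: $[e_1,e_4]=2e_1$, $[e_2,e_3]=e_1$, $[e_2,e_4]=e_2$, $[e_3,e_4]=e_2+e_3$; $\mathfrak{g}_{4,8}$: $[e_2,e_3]=e_1$, $[e_2,e_4]=e_2$, $[e_3,e_4]=-e_3$; $\mathfrak{g}_{4,9}$: $[e_1,e_4]=(p+1)e_1$, $[e_2,e_3]=e_1$, $[e_2,e_4]=e_2$, $[e_3,e_4]=pe_3$ ($-1<p\leq1$); $\mathfrak{g}_{4,10}$: $[e_2,e_3]=e_1$, $[e_2,e_4]=-e_3$, $[e_3,e_4]=e_2$; $\mathfrak{g}_{4,11}$: $[e_1,e_4]=2qe_1$, $[e_2,e_3]=e_1$, $[e_2,e_4]=qe_2-e_3$, $[e_3,e_4]=e_2+qe_3$ ($q>0$); $\mathfrak{g}_{4,12}$: $[e_1,e_3]=e_1$, $[e_1,e_4]=-e_2$, $[e_2,e_3]=e_2$, $[e_2,e_4]=e_1$. **Structure.** On $\mathcal{L}$, $e_1,\dots,e_4$ are regarded as left-invariant vector fields. The (left-invariant) almost hypercomplex structure $H=(J_1,J_2,J_3)$ is $J_1e_1=e_2$, $J_1e_2=-e_1$, $J_1e_3=-e_4$, $J_1e_4=e_3$; $J_2e_1=e_3$, $J_2e_2=e_4$, $J_2e_3=-e_1$, $J_2e_4=-e_2$; $J_3e_1=-e_4$, $J_3e_2=e_3$,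 $J_3e_3=-e_2$, $J_3e_4=e_1$. The left-invariant pseudo-Riemannian metric $g$ is given by $g(e_1,e_1)=g(e_2,e_2)=1$, $g(e_3,e_3)=g(e_4,e_4)=-1$, $g(e_i,e_j)=0$ for $i\neq j$. With $\varepsilon_1=1$, $\varepsilon_2=\varepsilon_3=-1$ one has $g(x,y)=\varepsilon_\alpha g(J_\alpha x,J_\alpha y)$ for $\alpha=1,2,3$; put $g_\alpha(x,y)=g(J_\alpha x,y)$ and $G=(g,g_1,g_2,g_3)$. **Fundamental tensors and Lee forms.** With $\nabla$ the Levi-Civita connection of $g$, $F_\alpha(x,y,z)=g((\nabla_xJ_\alpha)y,z)$ and $\theta_\alpha(z)=g^{ij}F_\alpha(e_i,e_j,z)$, where $(g^{ij})$ is the inverse matrix of $(g(e_i,e_j))$ and repeated indices are summed. These satisfy $F_\alpha(x,y,z)=-\varepsilon_\alpha F_\alpha(x,z,y)=-\varepsilon_\alpha F_\alpha(x,J_\alpha y,J_\alpha z)$. **Classes.** For each $\alpha$, consider the vector space of $(0,3)$-tensors $F_\alpha$ having the last-mentioned symmetries, with $\theta_\alpha$ the associated trace. The basic classes are the following subspaces ($\mathfrak{S}$ denotes the cyclic sum over $x,y,z$). For $J_1$ (almost Hermitian, dimension 4): $\mathcal{W}_2(J_1)$: $\mathfrak{S}_{x,y,z}\,F_1(x,y,z)=0$; $\mathcal{W}_4(J_1)$: $F_1(x,y,z)=\frac12\{g(x,y)\theta_1(z)-g(x,J_1y)\theta_1(J_1z)-g(x,z)\theta_1(y)+g(x,J_1z)\theta_1(J_1y)\}$.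 For $J_\alpha$, $\alpha=2,3$ (almost complex with Norden metric, dimension 4): $\mathcal{W}_1(J_\alpha)$: $F_\alpha(x,y,z)=\frac14\{g(x,y)\theta_\alpha(z)+g(x,J_\alpha y)\theta_\alpha(J_\alpha z)+g(x,z)\theta_\alpha(y)+g(x,J_\alpha z)\theta_\alpha(J_\alpha y)\}$; $\mathcal{W}_2(J_\alpha)$: $\mathfrak{S}_{x,y,z}\,F_\alpha(x,y,J_\alpha z)=0$ and $\theta_\alpha=0$; $\mathcal{W}_3(J_\alpha)$: $\mathfrak{S}_{x,y,z}\,F_\alpha(x,y,z)=0$. $\mathcal{W}_0(J_\alpha)$ is the class $F_\alpha=0$. The manifold belongs to a direct sum of basic classes with respect to $J_\alpha$ when its tensor $F_\alpha$ lies in the direct sum of the corresponding subspaces.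
   Formalization: In (i), the claims that J_2 is not in W_13 and that J_3 is not in W_1 or W_13 are stated only for (a_1,a_2) ≠ (1,1); at a_1=a_2=1 they are false, since both F_2 and F_3 lie in W_1 (for J_2 by the table itself). *)

theory Defs
  imports "HOL-Analysis.Analysis"
begin

section \<open>Smooth manifolds and Lie groups\<close>

primrec Ck_on :: "nat \<Rightarrow> 'a::euclidean_space set \<Rightarrow> ('a \<Rightarrow> 'b::real_normed_vector) \<Rightarrow> bool" where
  "Ck_on 0 S f \<longleftrightarrow> continuous_on S f"
| "Ck_on (Suc k) S f \<longleftrightarrow>
     f differentiable_on S \<and> (\<forall>v. Ck_on k S (\<lambda>x. frechet_derivative f (at x) v))"

text \<open>\<^term>\<open>smooth_on S f\<close> is only used for open \<^term>\<open>S\<close>.\<close>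

definition smooth_on :: "'a::euclidean_space set \<Rightarrow> ('a \<Rightarrow> 'b::real_normed_vector) \<Rightarrow> bool" where
  "smooth_on S f \<longleftrightarrow> (\<forall>k. Ck_on k S f)"

type_synonym ('p, 'e) atlas = "('p set \<times> ('p \<Rightarrow> 'e)) set"

definition smooth_atlas :: "('p::{t2_space,second_countable_topology}, 'e::euclidean_space) atlas \<Rightarrow> bool" where
  "smooth_atlas A \<longleftrightarrow>
     (\<Union>(U, \<phi>)\<in>A. U) = UNIV \<and>
     (\<forall>(U, \<phi>)\<in>A. open U \<and> open (\<phi> ` U) \<and> homeomorphism U (\<phi> ` U) \<phi> (inv_into U \<phi>)) \<and>
     (\<forall>(U, \<phi>)\<in>A. \<forall>(V, \<psi>)\<in>A. smooth_on (\<phi> ` (U \<inter> V)) (\<psi> \<circ> inv_into U \<phi>))"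

definition smooth_map ::
  "('p::topological_space, 'd::euclidean_space) atlas \<Rightarrow> ('q::topological_space, 'e::euclidean_space) atlas
    \<Rightarrow> ('p \<Rightarrow> 'q) \<Rightarrow> bool" where
  "smooth_map A B f \<longleftrightarrow>
     continuous_on UNIV f \<and>
     (\<forall>(U, \<phi>)\<in>A. \<forall>(V, \<psi>)\<in>B. smooth_on (\<phi> ` (U \<inter> f -` V)) (\<psi> \<circ> f \<circ> inv_into U \<phi>))"

definition prod_atlas :: "('p, 'd) atlas \<Rightarrow> ('q, 'e) atlas \<Rightarrow> ('p \<times> 'q, 'd \<times> 'e) atlas" where
  "prod_atlas A B = (\<Union>(U, \<phi>)\<in>A. \<Union>(V, \<psi>)\<in>B. {(U \<times> V, map_prod \<phi> \<psi>)})"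

definition lie_group ::
  "('p::{t2_space,second_countable_topology}, 'e::euclidean_space) atlas
    \<Rightarrow> ('p \<Rightarrow> 'p \<Rightarrow> 'p) \<Rightarrow> 'p \<Rightarrow> ('p \<Rightarrow> 'p) \<Rightarrow> bool" where
  "lie_group A mul one inver \<longleftrightarrow>
     smooth_atlas A \<and> group mul one inver \<and>
     smooth_map (prod_atlas A A) A (\<lambda>(a, b). mul a b) \<and> smooth_map A A inver"

definition smooth_fun :: "('p, 'e::euclidean_space) atlas \<Rightarrow> ('p \<Rightarrow> real) \<Rightarrow> bool" where
  "smooth_fun A f \<longleftrightarrow> (\<forall>(U, \<phi>)\<in>A. smooth_on (\<phi> ` U) (f \<circ> inv_into U \<phi>))"


section \<open>Vector fields, metrics and connections\<close>

text \<open>A vector field is a derivation of the algebra of smooth functions.  Its value on functions that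
  are not smooth is fixed to be \<open>0\<close>, so that vector fields are equal iff they agree on smooth functions.\<close>

type_synonym 'p vf = "('p \<Rightarrow> real) \<Rightarrow> 'p \<Rightarrow> real"

definition vector_field :: "('p, 'e::euclidean_space) atlas \<Rightarrow> 'p vf \<Rightarrow> bool" where
  "vector_field A X \<longleftrightarrow>
     (\<forall>f. smooth_fun A f \<longrightarrow> smooth_fun A (X f)) \<and>
     (\<forall>f. \<not> smooth_fun A f \<longrightarrow> X f = (\<lambda>_. 0)) \<and>
     (\<forall>f h. smooth_fun A f \<longrightarrow> smooth_fun A h \<longrightarrow> X (\<lambda>q. f q + h q) = (\<lambda>q. X f q + X h q)) \<and>
     (\<forall>c f. smooth_fun A f \<longrightarrow> X (\<lambda>q. c * f q) = (\<lambda>q. c * X f q)) \<and>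
     (\<forall>f h. smooth_fun A f \<longrightarrow> smooth_fun A h \<longrightarrow>
        X (\<lambda>q. f q * h q) = (\<lambda>q. f q * X h q + h q * X f q))"

definition vadd :: "'p vf \<Rightarrow> 'p vf \<Rightarrow> 'p vf" where
  "vadd X Y = (\<lambda>f q. X f q + Y f q)"

definition vdiff :: "'p vf \<Rightarrow> 'p vf \<Rightarrow> 'p vf" where
  "vdiff X Y = (\<lambda>f q. X f q - Y f q)"

definition vscale :: "('p \<Rightarrow> real) \<Rightarrow> 'p vf \<Rightarrow> 'p vf" where
  "vscale h X = (\<lambda>f q. h q * X f q)"

definition lie_bracket :: "'p vf \<Rightarrow> 'p vf \<Rightarrow> 'p vf" where
  "lie_bracket X Y = (\<lambda>f q. X (Y f) q - Y (X f) q)"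

definition left_invariant :: "('p, 'e::euclidean_space) atlas \<Rightarrow> ('p \<Rightarrow> 'p \<Rightarrow> 'p) \<Rightarrow> 'p vf \<Rightarrow> bool" where
  "left_invariant A mul X \<longleftrightarrow>
     vector_field A X \<and> (\<forall>a f. smooth_fun A f \<longrightarrow> X (f \<circ> mul a) = X f \<circ> mul a)"

definition endomorphism_field :: "('p, 'e::euclidean_space) atlas \<Rightarrow> ('p vf \<Rightarrow> 'p vf) \<Rightarrow> bool" where
  "endomorphism_field A J \<longleftrightarrow>
     (\<forall>X. vector_field A X \<longrightarrow> vector_field A (J X)) \<and>
     (\<forall>X Y. vector_field A X \<longrightarrow> vector_field A Y \<longrightarrow> J (vadd X Y) = vadd (J X) (J Y)) \<and>
     (\<forall>h X. smooth_fun A h \<longrightarrow> vector_field A X \<longrightarrow> J (vscale h X) = vscale h (J X))"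

text \<open>The last clause is non-degeneracy at every point: a field vanishes at \<open>p\<close> iff it annihilates all
  functions at \<open>p\<close>.\<close>

definition pseudo_riemannian :: "('p, 'e::euclidean_space) atlas \<Rightarrow> ('p vf \<Rightarrow> 'p vf \<Rightarrow> 'p \<Rightarrow> real) \<Rightarrow> bool" where
  "pseudo_riemannian A g \<longleftrightarrow>
     (\<forall>X Y. vector_field A X \<longrightarrow> vector_field A Y \<longrightarrow> smooth_fun A (g X Y) \<and> g X Y = g Y X) \<and>
     (\<forall>X Y Z. vector_field A X \<longrightarrow> vector_field A Y \<longrightarrow> vector_field A Z \<longrightarrow>
        g (vadd X Y) Z = (\<lambda>q. g X Z q + g Y Z q)) \<and>
     (\<forall>h X Y. smooth_fun A h \<longrightarrow> vector_field A X \<longrightarrow> vector_field A Y \<longrightarrow>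
        g (vscale h X) Y = (\<lambda>q. h q * g X Y q)) \<and>
     (\<forall>p X. vector_field A X \<longrightarrow> (\<forall>Y. vector_field A Y \<longrightarrow> g X Y p = 0) \<longrightarrow> (\<forall>f. X f p = 0))"

definition affine_connection :: "('p, 'e::euclidean_space) atlas \<Rightarrow> ('p vf \<Rightarrow> 'p vf \<Rightarrow> 'p vf) \<Rightarrow> bool" where
  "affine_connection A N \<longleftrightarrow>
     (\<forall>X Y. vector_field A X \<longrightarrow> vector_field A Y \<longrightarrow> vector_field A (N X Y)) \<and>
     (\<forall>X Y Z. vector_field A X \<longrightarrow> vector_field A Y \<longrightarrow> vector_field A Z \<longrightarrow>
        N (vadd X Y) Z = vadd (N X Z) (N Y Z) \<and> N X (vadd Y Z) = vadd (N X Y) (N X Z)) \<and>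
     (\<forall>h X Y. smooth_fun A h \<longrightarrow> vector_field A X \<longrightarrow> vector_field A Y \<longrightarrow>
        N (vscale h X) Y = vscale h (N X Y) \<and>
        N X (vscale h Y) = vadd (vscale (X h) Y) (vscale h (N X Y)))"

definition levi_civita ::
  "('p, 'e::euclidean_space) atlas \<Rightarrow> ('p vf \<Rightarrow> 'p vf \<Rightarrow> 'p \<Rightarrow> real) \<Rightarrow> ('p vf \<Rightarrow> 'p vf \<Rightarrow> 'p vf) \<Rightarrow> bool" where
  "levi_civita A g N \<longleftrightarrow>
     affine_connection A N \<and>
     (\<forall>X Y. vector_field A X \<longrightarrow> vector_field A Y \<longrightarrow> vdiff (N X Y) (N Y X) = lie_bracket X Y) \<and>
     (\<forall>X Y Z. vector_field A X \<longrightarrow> vector_field A Y \<longrightarrow> vector_field A Z \<longrightarrow>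
        X (g Y Z) = (\<lambda>q. g (N X Y) Z q + g Y (N X Z) q))"

text \<open>\<open>F(X, Y, Z) = g((\<nabla>\<^sub>X J) Y, Z)\<close> with \<open>(\<nabla>\<^sub>X J) Y = \<nabla>\<^sub>X (J Y) - J (\<nabla>\<^sub>X Y)\<close>.\<close>

definition fundamental_tensor ::
  "('p vf \<Rightarrow> 'p vf \<Rightarrow> 'p \<Rightarrow> real) \<Rightarrow> ('p vf \<Rightarrow> 'p vf \<Rightarrow> 'p vf) \<Rightarrow> ('p vf \<Rightarrow> 'p vf)
    \<Rightarrow> 'p vf \<Rightarrow> 'p vf \<Rightarrow> 'p vf \<Rightarrow> 'p \<Rightarrow> real" where
  "fundamental_tensor g N J X Y Z = g (vdiff (N X (J Y)) (J (N X Y))) Z"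


section \<open>The structure with respect to the basis\<close>

text \<open>A vector \<open>x\<close> of \<^typ>\<open>real^4\<close> stands for \<open>x\<^sub>1 e\<^sub>1 + \<dots> + x\<^sub>4 e\<^sub>4\<close>.\<close>

abbreviation E :: "4 \<Rightarrow> real^4" where
  "E i \<equiv> axis i 1"

definition Jmap :: "3 \<Rightarrow> real^4 \<Rightarrow> real^4" where
  "Jmap \<alpha> x =
    (if \<alpha> = 1 then x$1 *\<^sub>R E 2 + x$2 *\<^sub>R (- E 1) + x$3 *\<^sub>R (- E 4) + x$4 *\<^sub>R E 3
     else if \<alpha> = 2 then x$1 *\<^sub>R E 3 + x$2 *\<^sub>R E 4 + x$3 *\<^sub>R (- E 1) + x$4 *\<^sub>R (- E 2)
     else x$1 *\<^sub>R (- E 4) + x$2 *\<^sub>R E 3 + x$3 *\<^sub>R (- E 2) + x$4 *\<^sub>R E 1)"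

definition hn_metric :: "real^4 \<Rightarrow> real^4 \<Rightarrow> real" where
  "hn_metric x y = x$1 * y$1 + x$2 * y$2 - x$3 * y$3 - x$4 * y$4"

definition eps :: "3 \<Rightarrow> real" where
  "eps \<alpha> = (if \<alpha> = 1 then 1 else -1)"

text \<open>An entry \<open>((i, j), v)\<close> of \<open>brackets\<close> stands for \<open>[e\<^sub>i, e\<^sub>j] = v\<close>; \<open>bracket\<close> completes the table
  by antisymmetry and zeros.\<close>

datatype lie_alg =
  G41 | G42 real | G43 | G44 | G45 real real | G46 real real
| G47 | G48 | G49 real | G410 | G411 real | G412

primrec brackets :: "lie_alg \<Rightarrow> ((4 \<times> 4) \<times> (real^4)) list" where
  "brackets G41 = [((2,4), E 1), ((3,4), E 2)]"
| "brackets (G42 m) = [((1,4), m *\<^sub>R E 1), ((2,4), E 2), ((3,4), E 2 + E 3)]"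
| "brackets G43 = [((1,4), E 1), ((3,4), E 2)]"
| "brackets G44 = [((1,4), E 1), ((2,4), E 1 + E 2), ((3,4), E 2 + E 3)]"
| "brackets (G45 a1 a2) = [((1,4), E 1), ((2,4), a1 *\<^sub>R E 2), ((3,4), a2 *\<^sub>R E 3)]"
| "brackets (G46 b1 b2) =
     [((1,4), b1 *\<^sub>R E 1), ((2,4), b2 *\<^sub>R E 2 - E 3), ((3,4), E 2 + b2 *\<^sub>R E 3)]"
| "brackets G47 = [((1,4), 2 *\<^sub>R E 1), ((2,3), E 1), ((2,4), E 2), ((3,4), E 2 + E 3)]"
| "brackets G48 = [((2,3), E 1), ((2,4), E 2), ((3,4), - E 3)]"
| "brackets (G49 p) = [((1,4), (p + 1) *\<^sub>R E 1), ((2,3), E 1), ((2,4), E 2), ((3,4), p *\<^sub>R E 3)]"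
| "brackets G410 = [((2,3), E 1), ((2,4), - E 3), ((3,4), E 2)]"
| "brackets (G411 q) =
     [((1,4), (2 * q) *\<^sub>R E 1), ((2,3), E 1), ((2,4), q *\<^sub>R E 2 - E 3), ((3,4), E 2 + q *\<^sub>R E 3)]"
| "brackets G412 = [((1,3), E 1), ((1,4), - E 2), ((2,3), E 2), ((2,4), E 1)]"

definition bracket :: "lie_alg \<Rightarrow> 4 \<Rightarrow> 4 \<Rightarrow> real^4" where
  "bracket l i j =
    (case map_of (brackets l) (i, j) of
       Some v \<Rightarrow> v
     | None \<Rightarrow> (case map_of (brackets l) (j, i) of Some v \<Rightarrow> - v | None \<Rightarrow> 0))"

definition comb :: "(4 \<Rightarrow> 'p vf) \<Rightarrow> real^4 \<Rightarrow> 'p vf" where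
  "comb e x = (\<lambda>f q. \<Sum>i\<in>UNIV. x$i * e i f q)"

text \<open>The clause \<open>basis\<close> says that \<open>e\<^sub>1, \<dots>, e\<^sub>4\<close> is a basis of the Lie algebra of left-invariant vector
  fields.  The associated tensors \<open>g\<^sub>\<alpha>(X, Y) = g(J\<^sub>\<alpha> X, Y)\<close> are determined by \<open>g\<close> and \<open>J\<^sub>\<alpha>\<close>, so
  they are not a separate parameter.\<close>

locale hypercomplex_HN_lie_group =
  fixes l :: lie_alg
    and A :: "('p::{t2_space,second_countable_topology}, real^4) atlas"
    and mul :: "'p \<Rightarrow> 'p \<Rightarrow> 'p" and one :: 'p and inver :: "'p \<Rightarrow> 'p"
    and e :: "4 \<Rightarrow> 'p vf"
    and J :: "3 \<Rightarrow> 'p vf \<Rightarrow> 'p vf"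
    and g :: "'p vf \<Rightarrow> 'p vf \<Rightarrow> 'p \<Rightarrow> real"
    and N :: "'p vf \<Rightarrow> 'p vf \<Rightarrow> 'p vf"
  assumes lie_group: "lie_group A mul one inver"
    and simply_connected: "simply_connected (UNIV :: 'p set)"
    and basis: "bij_betw (comb e) UNIV {X. left_invariant A mul X}"
    and bracket_eq: "lie_bracket (e i) (e j) = comb e (bracket l i j)"
    and J_endo: "endomorphism_field A (J \<alpha>)"
    and J_values: "J \<alpha> (comb e x) = comb e (Jmap \<alpha> x)"
    and J_square: "vector_field A X \<Longrightarrow> J \<alpha> (J \<alpha> X) = vscale (\<lambda>_. -1) X"
    and J_quaternion: "vector_field A X \<Longrightarrow> J 1 (J 2 X) = J 3 X"
    and g_metric: "pseudo_riemannian A g"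
    and g_values: "g (comb e x) (comb e y) = (\<lambda>_. hn_metric x y)"
    and g_compatible: "vector_field A X \<Longrightarrow> vector_field A Y \<Longrightarrow>
      g X Y = (\<lambda>q. eps \<alpha> * g (J \<alpha> X) (J \<alpha> Y) q)"
    and levi_civita: "levi_civita A g N"


section \<open>Classes\<close>

type_synonym tensor3 = "real^4 \<Rightarrow> real^4 \<Rightarrow> real^4 \<Rightarrow> real"

definition trilinear :: "tensor3 \<Rightarrow> bool" where
  "trilinear T \<longleftrightarrow>
     (\<forall>y z. linear (\<lambda>x. T x y z)) \<and> (\<forall>x z. linear (\<lambda>y. T x y z)) \<and> (\<forall>x y. linear (\<lambda>z. T x y z))"

definition lee_form :: "tensor3 \<Rightarrow> real^4 \<Rightarrow> real" where
  "lee_form T z =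
     (\<Sum>i\<in>UNIV. \<Sum>j\<in>UNIV. matrix_inv (\<chi> i j. hn_metric (E i) (E j)) $ i $ j * T (E i) (E j) z)"

definition tensor_space :: "3 \<Rightarrow> tensor3 set" where
  "tensor_space \<alpha> = {T. trilinear T \<and>
     (\<forall>x y z. T x y z = - eps \<alpha> * T x z y \<and> T x y z = - eps \<alpha> * T x (Jmap \<alpha> y) (Jmap \<alpha> z))}"

text \<open>Index \<open>0\<close> stands for \<open>\<W>\<^sub>0\<close>.\<close>

definition basic_class_J1 :: "nat \<Rightarrow> tensor3 \<Rightarrow> bool" where
  "basic_class_J1 i T \<longleftrightarrow>
     i = 0 \<and> (\<forall>x y z. T x y z = 0) \<or>
     i = 2 \<and> (\<forall>x y z. T x y z + T y z x + T z x y = 0) \<or>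
     i = 4 \<and> (\<forall>x y z. T x y z = 1/2 *
       (hn_metric x y * lee_form T z - hn_metric x (Jmap 1 y) * lee_form T (Jmap 1 z)
        - hn_metric x z * lee_form T y + hn_metric x (Jmap 1 z) * lee_form T (Jmap 1 y)))"

definition basic_class_Norden :: "3 \<Rightarrow> nat \<Rightarrow> tensor3 \<Rightarrow> bool" where
  "basic_class_Norden \<alpha> i T \<longleftrightarrow>
     i = 0 \<and> (\<forall>x y z. T x y z = 0) \<or>
     i = 1 \<and> (\<forall>x y z. T x y z = 1/4 *
       (hn_metric x y * lee_form T z + hn_metric x (Jmap \<alpha> y) * lee_form T (Jmap \<alpha> z)
        + hn_metric x z * lee_form T y + hn_metric x (Jmap \<alpha> z) * lee_form T (Jmap \<alpha> y))) \<or>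
     i = 2 \<and> (\<forall>x y z. T x y (Jmap \<alpha> z) + T y z (Jmap \<alpha> x) + T z x (Jmap \<alpha> y) = 0) \<and>
       (\<forall>z. lee_form T z = 0) \<or>
     i = 3 \<and> (\<forall>x y z. T x y z + T y z x + T z x y = 0)"

definition basic_class :: "3 \<Rightarrow> nat \<Rightarrow> tensor3 set" where
  "basic_class \<alpha> i =
     {T \<in> tensor_space \<alpha>. if \<alpha> = 1 then basic_class_J1 i T else basic_class_Norden \<alpha> i T}"

text \<open>The basic classes are independent subspaces, so their sum is the direct sum.\<close>

definition direct_sum_class :: "3 \<Rightarrow> nat set \<Rightarrow> tensor3 set" where
  "direct_sum_class \<alpha> I =
     {(\<lambda>x y z. \<Sum>i\<in>I. D i x y z) | D. \<forall>i\<in>I. D i \<in> basic_class \<alpha> i}"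

text \<open>The tangent space at \<open>p\<close> is identified with \<^typ>\<open>real^4\<close> by evaluating the left-invariant
  field \<^term>\<open>comb e x\<close> at \<open>p\<close>; the fundamental tensor has to lie in the class at every point.\<close>

definition in_class ::
  "(4 \<Rightarrow> 'p vf) \<Rightarrow> (3 \<Rightarrow> 'p vf \<Rightarrow> 'p vf) \<Rightarrow> ('p vf \<Rightarrow> 'p vf \<Rightarrow> 'p \<Rightarrow> real) \<Rightarrow> ('p vf \<Rightarrow> 'p vf \<Rightarrow> 'p vf)
    \<Rightarrow> 3 \<Rightarrow> nat set \<Rightarrow> bool" where
  "in_class e J g N \<alpha> I \<longleftrightarrow>
     (\<forall>p. (\<lambda>x y z. fundamental_tensor g N (J \<alpha>) (comb e x) (comb e y) (comb e z) p)
          \<in> direct_sum_class \<alpha> I)"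

definition in_classes ::
  "(4 \<Rightarrow> 'p vf) \<Rightarrow> (3 \<Rightarrow> 'p vf \<Rightarrow> 'p vf) \<Rightarrow> ('p vf \<Rightarrow> 'p vf \<Rightarrow> 'p \<Rightarrow> real) \<Rightarrow> ('p vf \<Rightarrow> 'p vf \<Rightarrow> 'p vf)
    \<Rightarrow> nat set \<Rightarrow> nat set \<Rightarrow> nat set \<Rightarrow> bool" where
  "in_classes e J g N I1 I2 I3 \<longleftrightarrow>
     in_class e J g N 1 I1 \<and> in_class e J g N 2 I2 \<and> in_class e J g N 3 I3"

definition in_none ::
  "(4 \<Rightarrow> 'p vf) \<Rightarrow> (3 \<Rightarrow> 'p vf \<Rightarrow> 'p vf) \<Rightarrow> ('p vf \<Rightarrow> 'p vf \<Rightarrow> 'p \<Rightarrow> real) \<Rightarrow> ('p vf \<Rightarrow> 'p vf \<Rightarrow> 'p vf)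
    \<Rightarrow> nat set set \<Rightarrow> nat set set \<Rightarrow> nat set set \<Rightarrow> bool" where
  "in_none e J g N C1 C2 C3 \<longleftrightarrow>
     (\<forall>I\<in>C1. \<not> in_class e J g N 1 I) \<and> (\<forall>I\<in>C2. \<not> in_class e J g N 2 I) \<and>
     (\<forall>I\<in>C3. \<not> in_class e J g N 3 I)"

end

theory Submission
  imports Defs
begin

text \<open>On left-invariant fields the metric is constant, so the Koszul formula determines the Levi-Civita
connection in terms of the Lie bracket alone.  Together with \<open>J\<^sup>2 = -1\<close> and the compatibility of \<open>g\<close>
with \<open>J\<close> this gives, at every point of the group,
\<open>F(x, y, z) = K(x, J y, z) + \<epsilon> K(x, y, J z)\<close>, where \<open>K(x, y, z) = g(\<nabla>\<^sub>x y, z)\<close> is half of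
\<open>g([x, y], z) - g([y, z], x) + g([z, x], y)\<close>.  Membership in a class is thereby a question about
one trilinear form on \<open>\<real>\<^sup>4\<close>, whose coefficients are affine functions of the parameters of the Lie
algebra (\<open>fundamental_tensor_eq\<close>, \<open>in_class_iff\<close>).

A direct sum of basic classes is described by linear equations.  For \<open>J\<^sub>1\<close> every tensor is the
sum of its trace part, which lies in \<open>\<W>\<^sub>4\<close>, and a trace-free tensor; in dimension four the
cyclic sum of the latter vanishes, so that \<open>\<W>\<^sub>2 \<oplus> \<W>\<^sub>4\<close> is everything (\<open>hermitian_W24\<close>).
For \<open>J\<^sub>2\<close> and \<open>J\<^sub>3\<close> there are explicit projections to \<open>\<W>\<^sub>1\<close> (the trace part) and to \<open>\<W>\<^sub>3\<close> (the
skew part), and what remains lies in \<open>\<W>\<^sub>2\<close> (\<open>norden_W123\<close>).  They show that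
\<open>\<W>\<^sub>1 \<oplus> \<W>\<^sub>2\<close> is cut out by the vanishing of the cyclic sum of \<open>F(x, y, J z)\<close>, and
\<open>\<W>\<^sub>2 \<oplus> \<W>\<^sub>3\<close> by the vanishing of the Lee form; on \<open>\<W>\<^sub>1 \<oplus> \<W>\<^sub>3\<close> the cyclic sums of \<open>F\<close> and of its
trace part agree (\<open>norden_W12_iff\<close>, \<open>norden_W23_iff\<close>, \<open>norden_W13_cyclic\<close>).

It remains to evaluate these equations.  A positive entry of the classification is a polynomial identity
in the coordinates of the arguments; for a negative one it is enough to find basis vectors at which an
equation fails, and since the classes grow with the index set, the failures for the two-element sums
\<open>\<W>\<^sub>1\<^sub>2\<close>, \<open>\<W>\<^sub>1\<^sub>3\<close>, \<open>\<W>\<^sub>2\<^sub>3\<close> also exclude their summands.\<close>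

section \<open>Linear algebra of the hypercomplex structure on \<open>\<real>\<^sup>4\<close>\<close>

lemma linear_Jmap: "linear (Jmap \<alpha>)"
  by (auto simp: Jmap_def linear_iff algebra_simps)

lemma Jmap_Jmap: "Jmap \<alpha> (Jmap \<alpha> x) = - x"
  by (simp add: Jmap_def vec_eq_iff forall_4 axis_def)

lemma bilinear_hn_metric: "bilinear hn_metric"
  by (auto simp: hn_metric_def bilinear_def linear_iff algebra_simps)

lemma hn_metric_sym: "hn_metric x y = hn_metric y x"
  by (simp add: hn_metric_def)

lemma hn_metric_Jmap_left: "hn_metric (Jmap \<alpha> x) y = - eps \<alpha> * hn_metric x (Jmap \<alpha> y)"
  by (simp add: hn_metric_def Jmap_def eps_def axis_def)

lemma trilinearD:
  assumes "trilinear T"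
  shows "T (x + x') y z = T x y z + T x' y z" "T x (y + y') z = T x y z + T x y' z"
    "T x y (z + z') = T x y z + T x y z'"
    "T (c *\<^sub>R x) y z = c * T x y z" "T x (c *\<^sub>R y) z = c * T x y z" "T x y (c *\<^sub>R z) = c * T x y z"
    "T (- x) y z = - T x y z" "T x (- y) z = - T x y z" "T x y (- z) = - T x y z"
proof -
  have lin: "linear (\<lambda>x. T x y z)" "linear (\<lambda>y. T x y z)" "linear (\<lambda>z. T x y z)" for x y z
    using assms by (simp_all add: trilinear_def)
  show "T (x + x') y z = T x y z + T x' y z" "T x (y + y') z = T x y z + T x y' z"
    "T x y (z + z') = T x y z + T x y z'"
    by (fact linear_add[OF lin(1)] linear_add[OF lin(2)] linear_add[OF lin(3)])+
  show "T (c *\<^sub>R x) y z = c * T x y z" "T x (c *\<^sub>R y) z = c * T x y z" "T x y (c *\<^sub>R z) = c * T x y z"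
    using linear_scale[OF lin(1)] linear_scale[OF lin(2)] linear_scale[OF lin(3)] by simp_all
  show "T (- x) y z = - T x y z" "T x (- y) z = - T x y z" "T x y (- z) = - T x y z"
    by (fact linear_neg[OF lin(1)] linear_neg[OF lin(2)] linear_neg[OF lin(3)])+
qed

text \<open>The Gram matrix of the basis is diagonal with entries \<open>\<plusminus>1\<close>, hence its own inverse.\<close>

lemma lee_form_eq: "lee_form T z = T (E 1) (E 1) z + T (E 2) (E 2) z - T (E 3) (E 3) z - T (E 4) (E 4) z"
proof -
  define D :: "real^4^4" where "D = (\<chi> i j. hn_metric (E i) (E j))"
  have "D ** D = mat 1"
    by (simp add: D_def matrix_matrix_mult_def mat_def hn_metric_def vec_eq_iff forall_4 sum_4 axis_def)
  then have "D ** matrix_inv D = mat 1"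
    using someI[of "\<lambda>B. D ** B = mat 1 \<and> B ** D = mat 1" D] by (simp add: matrix_inv_def)
  then have "matrix_inv D = D"
    using \<open>D ** D = mat 1\<close> by (metis matrix_mul_assoc matrix_mul_lid matrix_mul_rid)
  then show ?thesis
    unfolding lee_form_def D_def[symmetric] by (simp add: D_def hn_metric_def sum_4 axis_def)
qed

lemma linear_lee_form: "trilinear T \<Longrightarrow> linear (lee_form T)"
  by (simp add: linear_iff lee_form_eq trilinearD algebra_simps)

lemma lee_form_add: "lee_form (\<lambda>x y z. S x y z + T x y z) z = lee_form S z + lee_form T z"
  by (simp add: lee_form_eq)

lemma lee_form_diff: "lee_form (\<lambda>x y z. S x y z - T x y z) z = lee_form S z - lee_form T z"
  by (simp add: lee_form_eq)

lemma vec4_expand: "(x::real^4) = x$1 *\<^sub>R E 1 + x$2 *\<^sub>R E 2 + x$3 *\<^sub>R E 3 + x$4 *\<^sub>R E 4"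
  by (simp add: vec_eq_iff forall_4 axis_def)

lemma linear_functional_expand:
  fixes f :: "real^4 \<Rightarrow> real"
  assumes "linear f"
  shows "f x = x$1 * f (E 1) + x$2 * f (E 2) + x$3 * f (E 3) + x$4 * f (E 4)"
  by (subst vec4_expand[of x]) (simp add: linear_add[OF assms] linear_scale[OF assms])

lemma Jmap_basis:
  "Jmap 1 (E 1) = E 2" "Jmap 1 (E 2) = - E 1" "Jmap 1 (E 3) = - E 4" "Jmap 1 (E 4) = E 3"
  "Jmap 2 (E 1) = E 3" "Jmap 2 (E 2) = E 4" "Jmap 2 (E 3) = - E 1" "Jmap 2 (E 4) = - E 2"
  "Jmap 3 (E 1) = - E 4" "Jmap 3 (E 2) = E 3" "Jmap 3 (E 3) = - E 2" "Jmap 3 (E 4) = E 1"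
  by (simp_all add: Jmap_def axis_def)

lemma tensor_space_trilinear: "T \<in> tensor_space \<alpha> \<Longrightarrow> trilinear T"
  by (simp only: tensor_space_def mem_Collect_eq)

lemma tensor_spaceD:
  assumes "T \<in> tensor_space \<alpha>"
  shows "T x y z = - eps \<alpha> * T x z y" "T x y z = - eps \<alpha> * T x (Jmap \<alpha> y) (Jmap \<alpha> z)"
  using assms unfolding tensor_space_def by blast+

lemma trilinear_diff: "trilinear S \<Longrightarrow> trilinear T \<Longrightarrow> trilinear (\<lambda>x y z. S x y z - T x y z)"
  by (simp add: trilinear_def linear_compose_sub)

lemma tensor_space_diff:
  assumes "S \<in> tensor_space \<alpha>" "T \<in> tensor_space \<alpha>"
  shows "(\<lambda>x y z. S x y z - T x y z) \<in> tensor_space \<alpha>"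
  unfolding tensor_space_def
proof (intro CollectI conjI allI)
  fix x y z
  show "S x y z - T x y z = - eps \<alpha> * (S x z y - T x z y)"
    using tensor_spaceD(1)[OF assms(1), of x y z] tensor_spaceD(1)[OF assms(2), of x y z]
    by (simp add: right_diff_distrib)
  show "S x y z - T x y z = - eps \<alpha> * (S x (Jmap \<alpha> y) (Jmap \<alpha> z) - T x (Jmap \<alpha> y) (Jmap \<alpha> z))"
    using tensor_spaceD(2)[OF assms(1), of x y z] tensor_spaceD(2)[OF assms(2), of x y z]
    by (simp add: right_diff_distrib)
qed (use assms in \<open>simp add: tensor_space_trilinear trilinear_diff\<close>)

abbreviation cyclic_sum :: "tensor3 \<Rightarrow> tensor3" where
  "cyclic_sum T x y z \<equiv> T x y z + T y z x + T z x y"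

abbreviation cyclic_J_sum :: "3 \<Rightarrow> tensor3 \<Rightarrow> tensor3" where
  "cyclic_J_sum \<alpha> T x y z \<equiv> T x y (Jmap \<alpha> z) + T y z (Jmap \<alpha> x) + T z x (Jmap \<alpha> y)"

lemma direct_sum_class_single: "direct_sum_class \<alpha> {i} = basic_class \<alpha> i"
  by (auto simp: direct_sum_class_def)

lemma direct_sum_class_pair:
  assumes "i \<noteq> j"
  shows "T \<in> direct_sum_class \<alpha> {i, j} \<longleftrightarrow>
    (\<exists>P\<in>basic_class \<alpha> i. \<exists>Q\<in>basic_class \<alpha> j. T = (\<lambda>x y z. P x y z + Q x y z))"
proof
  assume "T \<in> direct_sum_class \<alpha> {i, j}"
  then obtain D where "T = (\<lambda>x y z. \<Sum>i\<in>{i, j}. D i x y z)" "\<forall>k\<in>{i, j}. D k \<in> basic_class \<alpha> k"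
    unfolding direct_sum_class_def by blast
  then show "\<exists>P\<in>basic_class \<alpha> i. \<exists>Q\<in>basic_class \<alpha> j. T = (\<lambda>x y z. P x y z + Q x y z)"
    using assms by (intro bexI[of _ "D i"] bexI[of _ "D j"]) auto
next
  assume "\<exists>P\<in>basic_class \<alpha> i. \<exists>Q\<in>basic_class \<alpha> j. T = (\<lambda>x y z. P x y z + Q x y z)"
  then obtain P Q where "P \<in> basic_class \<alpha> i" "Q \<in> basic_class \<alpha> j" "T = (\<lambda>x y z. P x y z + Q x y z)"
    by blast
  then show "T \<in> direct_sum_class \<alpha> {i, j}"
    unfolding direct_sum_class_def using assms
    by (intro CollectI exI[of _ "\<lambda>k. if k = i then P else Q"]) auto
qed

lemma direct_sum_class_triple:
  assumes "P \<in> basic_class \<alpha> i" "Q \<in> basic_class \<alpha> j" "R \<in> basic_class \<alpha> k" "distinct [i, j, k]"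
  shows "(\<lambda>x y z. P x y z + Q x y z + R x y z) \<in> direct_sum_class \<alpha> {i, j, k}"
  unfolding direct_sum_class_def using assms
  by (intro CollectI exI[of _ "\<lambda>m. if m = i then P else if m = j then Q else R"]) (auto simp: add.assoc)

section \<open>Classes of almost Hermitian tensors\<close>

text \<open>For fixed \<open>x\<close>, \<open>T x\<close> is a skew form that changes sign under \<open>J\<^sub>1\<close>.  In dimension four such
forms make up a plane, with coordinates the values at \<open>(e\<^sub>1, e\<^sub>3)\<close> and \<open>(e\<^sub>1, e\<^sub>4)\<close>.\<close>

lemma hermitian_expand:
  assumes "T \<in> tensor_space 1"
  shows "T x y z = T x (E 1) (E 3) * (y$1 * z$3 - y$3 * z$1 + y$2 * z$4 - y$4 * z$2)
    + T x (E 1) (E 4) * (y$1 * z$4 - y$4 * z$1 - y$2 * z$3 + y$3 * z$2)"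
proof -
  note tri = tensor_space_trilinear[OF assms]
  have skew: "T x b a = - T x a b" for a b
    using tensor_spaceD(1)[OF assms, of x b a] by (simp add: eps_def)
  have J: "T x (Jmap 1 a) (Jmap 1 b) = - T x a b" for a b
    using tensor_spaceD(2)[OF assms, of x a b] by (simp add: eps_def)
  have zero: "T x (E i) (E i) = 0" for i
    using skew[of "E i" "E i"] by simp
  have upper: "T x (E 1) (E 2) = 0" "T x (E 3) (E 4) = 0"
    "T x (E 2) (E 4) = T x (E 1) (E 3)" "T x (E 2) (E 3) = - T x (E 1) (E 4)"
    using J[of "E 1" "E 2"] J[of "E 3" "E 4"] J[of "E 1" "E 3"] J[of "E 1" "E 4"]
      skew[of "E 1" "E 2"] skew[of "E 3" "E 4"]
    by (simp_all add: Jmap_basis trilinearD[OF tri])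
  have lower: "T x (E 2) (E 1) = 0" "T x (E 4) (E 3) = 0" "T x (E 3) (E 1) = - T x (E 1) (E 3)"
    "T x (E 4) (E 1) = - T x (E 1) (E 4)" "T x (E 3) (E 2) = T x (E 1) (E 4)"
    "T x (E 4) (E 2) = - T x (E 1) (E 3)"
    using upper skew[of "E 1" "E 2"] skew[of "E 3" "E 4"] skew[of "E 1" "E 3"] skew[of "E 1" "E 4"]
      skew[of "E 2" "E 3"] skew[of "E 2" "E 4"] by linarith+
  have "T x y z = T x (y$1 *\<^sub>R E 1 + y$2 *\<^sub>R E 2 + y$3 *\<^sub>R E 3 + y$4 *\<^sub>R E 4)
      (z$1 *\<^sub>R E 1 + z$2 *\<^sub>R E 2 + z$3 *\<^sub>R E 3 + z$4 *\<^sub>R E 4)"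
    using vec4_expand[of y] vec4_expand[of z] by simp
  also have "\<dots> = T x (E 1) (E 3) * (y$1 * z$3 - y$3 * z$1 + y$2 * z$4 - y$4 * z$2)
    + T x (E 1) (E 4) * (y$1 * z$4 - y$4 * z$1 - y$2 * z$3 + y$3 * z$2)"
    unfolding trilinearD[OF tri] zero upper lower by (simp add: algebra_simps)
  finally show ?thesis .
qed

text \<open>The right-hand side of the equation that defines \<open>\<W>\<^sub>4\<close>: the tensor in \<open>\<W>\<^sub>4\<close> with the same Lee form
as \<open>T\<close>.\<close>

definition hermitian_trace_part :: "tensor3 \<Rightarrow> tensor3" where
  "hermitian_trace_part T x y z = 1/2 *
     (hn_metric x y * lee_form T z - hn_metric x (Jmap 1 y) * lee_form T (Jmap 1 z)
      - hn_metric x z * lee_form T y + hn_metric x (Jmap 1 z) * lee_form T (Jmap 1 y))"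

lemma trilinear_hermitian_trace_part:
  assumes "trilinear T"
  shows "trilinear (hermitian_trace_part T)"
  unfolding trilinear_def linear_iff
  by (simp add: hermitian_trace_part_def
      linear_add[OF linear_Jmap] linear_scale[OF linear_Jmap]
      linear_add[OF linear_lee_form[OF assms]] linear_scale[OF linear_lee_form[OF assms]]
      bilinear_ladd[OF bilinear_hn_metric] bilinear_radd[OF bilinear_hn_metric]
      bilinear_lmul[OF bilinear_hn_metric] bilinear_rmul[OF bilinear_hn_metric] field_simps)

lemma hermitian_trace_part_in_tensor_space:
  assumes "T \<in> tensor_space 1"
  shows "hermitian_trace_part T \<in> tensor_space 1"
proof -
  note tri = tensor_space_trilinear[OF assms]
  have "hermitian_trace_part T x y z = - eps 1 * hermitian_trace_part T x z y" for x y z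
    by (simp add: hermitian_trace_part_def eps_def)
  moreover have "hermitian_trace_part T x y z = - eps 1 * hermitian_trace_part T x (Jmap 1 y) (Jmap 1 z)" for x y z
    by (simp add: hermitian_trace_part_def eps_def Jmap_Jmap linear_neg[OF linear_lee_form[OF tri]]
       bilinear_rneg[OF bilinear_hn_metric])
  ultimately show ?thesis
    unfolding tensor_space_def using trilinear_hermitian_trace_part[OF tri] by blast
qed

lemma lee_form_hermitian_trace_part:
  assumes "trilinear T"
  shows "lee_form (hermitian_trace_part T) z = lee_form T z"
  unfolding lee_form_eq[of "hermitian_trace_part T"] hermitian_trace_part_def
  using linear_functional_expand[OF linear_lee_form[OF assms], of z]
    linear_functional_expand[OF linear_lee_form[OF assms], of "Jmap 1 z"]
  by (simp add: Jmap_basis hn_metric_def linear_neg[OF linear_lee_form[OF assms]])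
     (simp add: Jmap_def axis_def field_simps)

lemma hermitian_W4:
  assumes "T \<in> tensor_space 1"
  shows "hermitian_trace_part T \<in> basic_class 1 4"
proof -
  have "lee_form (hermitian_trace_part T) = lee_form T"
    using lee_form_hermitian_trace_part[OF tensor_space_trilinear[OF assms]] by blast
  then show ?thesis
    by (simp add: basic_class_def basic_class_J1_def hermitian_trace_part_in_tensor_space[OF assms])
       (simp add: hermitian_trace_part_def)
qed

text \<open>This is where dimension four enters.  By \<open>hermitian_expand\<close> the tensor has eight
coefficients \<open>a\<^sub>i\<close>, \<open>b\<^sub>i\<close>.  The cyclic sum is an alternating 3-form, which has only four components, and
these turn out to be the components of the Lee form up to a permutation and signs.\<close>

lemma hermitian_trace_free_cyclic:
  assumes "T \<in> tensor_space 1"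
  shows "cyclic_sum T x y z = cyclic_sum (hermitian_trace_part T) x y z"
proof -
  note tri = tensor_space_trilinear[OF assms]
  have lin: "linear (\<lambda>x. T x (E 1) (E 3))" "linear (\<lambda>x. T x (E 1) (E 4))"
    using tri by (simp_all add: trilinear_def)
  define a where "a i = T (E i) (E 1) (E 3)" for i
  define b where "b i = T (E i) (E 1) (E 4)" for i
  have T: "T x y z = (x$1 * a 1 + x$2 * a 2 + x$3 * a 3 + x$4 * a 4) * (y$1 * z$3 - y$3 * z$1 + y$2 * z$4 - y$4 * z$2)
    + (x$1 * b 1 + x$2 * b 2 + x$3 * b 3 + x$4 * b 4) * (y$1 * z$4 - y$4 * z$1 - y$2 * z$3 + y$3 * z$2)" for x y z
    unfolding a_def b_def
    using hermitian_expand[OF assms, of x y z] linear_functional_expand[OF lin(1), of x]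
      linear_functional_expand[OF lin(2), of x] by simp
  show ?thesis
    by (simp add: hermitian_trace_part_def lee_form_eq T hn_metric_def Jmap_def axis_def)
       (simp add: field_simps)
qed

lemma hermitian_W24:
  assumes "T \<in> tensor_space 1"
  shows "T \<in> direct_sum_class 1 {2, 4}"
proof -
  let ?Q = "hermitian_trace_part T"
  have "(\<lambda>x y z. T x y z - ?Q x y z) \<in> basic_class 1 2"
    using tensor_space_diff[OF assms hermitian_trace_part_in_tensor_space[OF assms]]
      hermitian_trace_free_cyclic[OF assms]
    by (simp add: basic_class_def basic_class_J1_def algebra_simps)
  moreover have "T = (\<lambda>x y z. (T x y z - ?Q x y z) + ?Q x y z)"
    by simp
  ultimately show ?thesis
    unfolding direct_sum_class_pair[of 2 4, simplified] using hermitian_W4[OF assms] by fast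
qed

text \<open>Reduces an identity between two tensors to the eight coefficients of \<open>hermitian_expand\<close>, which is much
cheaper than comparing polynomials in the twelve coordinates of the arguments.\<close>

lemma hermitian_tensor_eqI:
  assumes "S \<in> tensor_space 1" "T \<in> tensor_space 1"
    and "\<forall>i. S (E i) (E 1) (E 3) = T (E i) (E 1) (E 3) \<and> S (E i) (E 1) (E 4) = T (E i) (E 1) (E 4)"
  shows "S x y z = T x y z"
proof -
  have lin: "linear (\<lambda>x. F x (E 1) (E k))" if "F \<in> tensor_space 1" for F and k :: 4
    using tensor_space_trilinear[OF that] by (simp add: trilinear_def)
  have "S x (E 1) (E 3) = T x (E 1) (E 3)" "S x (E 1) (E 4) = T x (E 1) (E 4)"
    using assms(3) by (simp_all add: linear_functional_expand[OF lin[OF assms(1)], of x]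
        linear_functional_expand[OF lin[OF assms(2)], of x])
  then show ?thesis
    using hermitian_expand[OF assms(1), of x y z] hermitian_expand[OF assms(2), of x y z] by simp
qed

lemma hermitian_W2_iff:
  "T \<in> tensor_space 1 \<Longrightarrow> T \<in> direct_sum_class 1 {2} \<longleftrightarrow> (\<forall>x y z. cyclic_sum T x y z = 0)"
  by (simp add: direct_sum_class_single basic_class_def basic_class_J1_def)

lemma hermitian_W4_iff:
  "T \<in> tensor_space 1 \<Longrightarrow>
    T \<in> direct_sum_class 1 {4} \<longleftrightarrow> (\<forall>x y z. T x y z = hermitian_trace_part T x y z)"
  by (simp add: direct_sum_class_single basic_class_def basic_class_J1_def hermitian_trace_part_def)

lemma hermitian_W4I:
  assumes "T \<in> tensor_space 1"
    and "\<forall>i. T (E i) (E 1) (E 3) = hermitian_trace_part T (E i) (E 1) (E 3) \<and>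
      T (E i) (E 1) (E 4) = hermitian_trace_part T (E i) (E 1) (E 4)"
  shows "T \<in> direct_sum_class 1 {4}"
  unfolding hermitian_W4_iff[OF assms(1)]
  using hermitian_tensor_eqI[OF assms(1) hermitian_trace_part_in_tensor_space[OF assms(1)] assms(2)]
  by blast

section \<open>Classes of tensors of Norden type\<close>

lemma Norden_index: "(2::3) \<noteq> 1" "(3::3) \<noteq> 1"
  by simp_all

lemma norden_tensorD:
  assumes "T \<in> tensor_space \<alpha>" "\<alpha> \<noteq> 1"
  shows "T x z y = T x y z" "T x (Jmap \<alpha> y) (Jmap \<alpha> z) = T x y z" "T x z (Jmap \<alpha> y) = - T x y (Jmap \<alpha> z)"
proof -
  show sym: "T x z y = T x y z" for y z
    using tensor_spaceD(1)[OF assms(1), of x z y] assms(2) by (simp add: eps_def)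
  show J: "T x (Jmap \<alpha> y) (Jmap \<alpha> z) = T x y z" for y z
    using tensor_spaceD(2)[OF assms(1), of x y z] assms(2) by (simp add: eps_def)
  show "T x z (Jmap \<alpha> y) = - T x y (Jmap \<alpha> z)"
    using J[of y "Jmap \<alpha> z"] sym[of z "Jmap \<alpha> y"]
    by (simp add: Jmap_Jmap trilinearD[OF tensor_space_trilinear[OF assms(1)]])
qed

lemma norden_tensorI:
  assumes "trilinear T" "\<alpha> \<noteq> 1" "\<And>x y z. T x z y = T x y z"
    "\<And>x y z. T x (Jmap \<alpha> y) (Jmap \<alpha> z) = T x y z"
  shows "T \<in> tensor_space \<alpha>"
proof -
  have "\<forall>x y z. T x y z = - eps \<alpha> * T x z y \<and> T x y z = - eps \<alpha> * T x (Jmap \<alpha> y) (Jmap \<alpha> z)"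
  proof (intro allI conjI)
    fix x y z
    show "T x y z = - eps \<alpha> * T x z y"
      using assms(2) assms(3)[of x z y] by (simp add: eps_def)
    show "T x y z = - eps \<alpha> * T x (Jmap \<alpha> y) (Jmap \<alpha> z)"
      using assms(2) assms(4)[of x y z] by (simp add: eps_def)
  qed
  then show ?thesis
    unfolding tensor_space_def using assms(1) by blast
qed

text \<open>The twin form \<open>g(x, J y)\<close> of a Norden metric is symmetric.\<close>

lemma norden_metric_Jmap: "\<alpha> \<noteq> 1 \<Longrightarrow> hn_metric x (Jmap \<alpha> y) = hn_metric y (Jmap \<alpha> x)"
  using hn_metric_Jmap_left[of \<alpha> x y] hn_metric_sym[of "Jmap \<alpha> x" y] by (simp add: eps_def)

text \<open>The right-hand side of the equation that defines \<open>\<W>\<^sub>1\<close>: the tensor in \<open>\<W>\<^sub>1\<close> with the same Lee form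
as \<open>T\<close>.\<close>

definition norden_trace_part :: "3 \<Rightarrow> tensor3 \<Rightarrow> tensor3" where
  "norden_trace_part \<alpha> T x y z = 1/4 *
     (hn_metric x y * lee_form T z + hn_metric x (Jmap \<alpha> y) * lee_form T (Jmap \<alpha> z)
      + hn_metric x z * lee_form T y + hn_metric x (Jmap \<alpha> z) * lee_form T (Jmap \<alpha> y))"

lemma trilinear_norden_trace_part:
  assumes "trilinear T"
  shows "trilinear (norden_trace_part \<alpha> T)"
  unfolding trilinear_def linear_iff
  by (simp add: norden_trace_part_def
      linear_add[OF linear_Jmap] linear_scale[OF linear_Jmap]
      linear_add[OF linear_lee_form[OF assms]] linear_scale[OF linear_lee_form[OF assms]]
      bilinear_ladd[OF bilinear_hn_metric] bilinear_radd[OF bilinear_hn_metric]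
      bilinear_lmul[OF bilinear_hn_metric] bilinear_rmul[OF bilinear_hn_metric] field_simps)

lemma norden_trace_part_in_tensor_space:
  assumes "T \<in> tensor_space \<alpha>" "\<alpha> \<noteq> 1"
  shows "norden_trace_part \<alpha> T \<in> tensor_space \<alpha>"
proof (rule norden_tensorI)
  note tri = tensor_space_trilinear[OF assms(1)]
  show "trilinear (norden_trace_part \<alpha> T)"
    by (rule trilinear_norden_trace_part[OF tri])
  show "norden_trace_part \<alpha> T x z y = norden_trace_part \<alpha> T x y z" for x y z
    by (simp add: norden_trace_part_def)
  show "norden_trace_part \<alpha> T x (Jmap \<alpha> y) (Jmap \<alpha> z) = norden_trace_part \<alpha> T x y z" for x y z
    by (simp add: norden_trace_part_def Jmap_Jmap linear_neg[OF linear_lee_form[OF tri]]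
       bilinear_rneg[OF bilinear_hn_metric])
qed (rule assms(2))

lemma lee_form_norden_trace_part:
  assumes "trilinear T" "\<alpha> \<noteq> 1"
  shows "lee_form (norden_trace_part \<alpha> T) z = lee_form T z"
proof -
  have \<alpha>: "\<alpha> = 2 \<or> \<alpha> = 3"
    using assms(2) by (metis exhaust_3)
  \<comment> \<open>Up to the factor \<open>1/4\<close>, the four summands of the trace part contribute \<open>4 \<theta>(z)\<close>, \<open>0\<close>, \<open>\<theta>(z)\<close> and \<open>\<theta>(J (J z)) = - \<theta>(z)\<close>.\<close>
  show ?thesis
    unfolding lee_form_eq[of "norden_trace_part \<alpha> T"] norden_trace_part_def
    using linear_functional_expand[OF linear_lee_form[OF assms(1)], of z]
      linear_functional_expand[OF linear_lee_form[OF assms(1)], of "Jmap \<alpha> z"] \<alpha>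
    by (elim disjE; simp add: Jmap_basis hn_metric_def linear_neg[OF linear_lee_form[OF assms(1)]])
       (simp_all add: Jmap_def axis_def field_simps)
qed

lemma norden_W1:
  assumes "T \<in> tensor_space \<alpha>" "\<alpha> \<noteq> 1"
  shows "norden_trace_part \<alpha> T \<in> basic_class \<alpha> 1"
proof -
  have "lee_form (norden_trace_part \<alpha> T) = lee_form T"
    using lee_form_norden_trace_part[OF tensor_space_trilinear[OF assms(1)] assms(2)] by blast
  then show ?thesis
    using assms(2)
    by (simp add: basic_class_def basic_class_Norden_def norden_trace_part_in_tensor_space[OF assms])
       (simp add: norden_trace_part_def)
qed

text \<open>In the cyclic sum every term \<open>g(u, v) \<theta>(J w)\<close> and every term \<open>g(u, J v) \<theta>(w)\<close> occurs
twice with opposite signs, by the symmetry of the metric and of its twin.\<close>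

lemma norden_trace_part_nijenhuis:
  assumes "trilinear T" "\<alpha> \<noteq> 1"
  shows "cyclic_J_sum \<alpha> (norden_trace_part \<alpha> T) x y z = 0"
  using norden_metric_Jmap[OF assms(2), of z x] norden_metric_Jmap[OF assms(2), of z y]
    norden_metric_Jmap[OF assms(2), of y x]
    hn_metric_sym[of z x] hn_metric_sym[of z y] hn_metric_sym[of y x]
  by (simp add: norden_trace_part_def Jmap_Jmap linear_neg[OF linear_lee_form[OF assms(1)]]
       bilinear_rneg[OF bilinear_hn_metric]) (simp add: field_simps)

text \<open>After complexification a tensor with the Norden symmetries is determined by its components
\<open>T(a, b, c-bar)\<close> with \<open>a\<close>, \<open>b\<close> of type \<open>(1,0)\<close> and \<open>c-bar\<close> of type \<open>(0,1)\<close>.  The cyclic sum of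
\<open>T(x, y, z)\<close> vanishes if and only if these components are skew in \<open>a\<close>, \<open>b\<close>, and the cyclic sum of
\<open>T(x, y, J z)\<close> vanishes if and only if they are symmetric.  The formula below is the real expression of half
the difference of \<open>T(a, b, c-bar)\<close> and \<open>T(b, a, c-bar)\<close>, that is, of the projection to \<open>\<W>\<^sub>3\<close>.\<close>

definition norden_skew_part :: "3 \<Rightarrow> tensor3 \<Rightarrow> tensor3" where
  "norden_skew_part \<alpha> T x y z = 1/2 * T x y z - 1/4 * (T y x z + T z x y
     + T (Jmap \<alpha> y) x (Jmap \<alpha> z) + T (Jmap \<alpha> z) x (Jmap \<alpha> y))"

lemma norden_skew_part_in_tensor_space:
  assumes "T \<in> tensor_space \<alpha>" "\<alpha> \<noteq> 1"
  shows "norden_skew_part \<alpha> T \<in> tensor_space \<alpha>"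
proof (rule norden_tensorI)
  note tri = tensor_space_trilinear[OF assms(1)]
  show "trilinear (norden_skew_part \<alpha> T)"
    unfolding trilinear_def linear_iff
    by (simp add: norden_skew_part_def trilinearD[OF tri]
        linear_add[OF linear_Jmap] linear_scale[OF linear_Jmap] field_simps)
  show "norden_skew_part \<alpha> T x z y = norden_skew_part \<alpha> T x y z" for x y z
    using norden_tensorD(1)[OF assms, of x y z] by (simp add: norden_skew_part_def)
  show "norden_skew_part \<alpha> T x (Jmap \<alpha> y) (Jmap \<alpha> z) = norden_skew_part \<alpha> T x y z" for x y z
    using norden_tensorD(2)[OF assms, of x y z]
    by (simp add: norden_skew_part_def Jmap_Jmap trilinearD[OF tri])
qed (rule assms(2))

lemma norden_skew_part_cyclic:
  assumes "T \<in> tensor_space \<alpha>" "\<alpha> \<noteq> 1"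
  shows "cyclic_sum (norden_skew_part \<alpha> T) x y z = 0"
  using norden_tensorD(1)[OF assms, of x y z] norden_tensorD(1)[OF assms, of y x z]
    norden_tensorD(1)[OF assms, of z x y]
    norden_tensorD(3)[OF assms, of "Jmap \<alpha> z" x y] norden_tensorD(3)[OF assms, of "Jmap \<alpha> x" y z]
    norden_tensorD(3)[OF assms, of "Jmap \<alpha> y" x z]
  by (simp add: norden_skew_part_def) (simp add: field_simps)

lemma norden_W3:
  assumes "T \<in> tensor_space \<alpha>" "\<alpha> \<noteq> 1"
  shows "norden_skew_part \<alpha> T \<in> basic_class \<alpha> 3"
  using norden_skew_part_in_tensor_space[OF assms] norden_skew_part_cyclic[OF assms] assms(2)
  by (simp add: basic_class_def basic_class_Norden_def)

text \<open>The cyclic sum of \<open>T(x, y, J z)\<close> sees only the skew part of \<open>T\<close>; so removing the skew part makes it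
vanish.\<close>

lemma norden_skew_part_nijenhuis:
  assumes "T \<in> tensor_space \<alpha>" "\<alpha> \<noteq> 1"
  shows "cyclic_J_sum \<alpha> (norden_skew_part \<alpha> T) x y z = cyclic_J_sum \<alpha> T x y z"
  using norden_tensorD(3)[OF assms, of x y z] norden_tensorD(3)[OF assms, of y z x]
    norden_tensorD(3)[OF assms, of z x y]
    norden_tensorD(1)[OF assms, of "Jmap \<alpha> x" y z] norden_tensorD(1)[OF assms, of "Jmap \<alpha> y" x z]
    norden_tensorD(1)[OF assms, of "Jmap \<alpha> z" x y]
  by (simp add: norden_skew_part_def Jmap_Jmap trilinearD[OF tensor_space_trilinear[OF assms(1)]])
    (simp add: field_simps)

text \<open>Tracing the cyclic identity over \<open>x = y\<close> gives \<open>2 \<theta>(z)\<close> plus the trace of \<open>T z\<close>; the latter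
vanishes because \<open>T z\<close> is invariant under \<open>J\<close> while the metric changes sign.\<close>

lemma norden_cyclic_imp_trace_free:
  assumes "T \<in> tensor_space \<alpha>" "\<alpha> \<noteq> 1"
    and cyc: "\<And>x y z. cyclic_sum T x y z = 0"
  shows "lee_form T z = 0"
proof -
  note tri = tensor_space_trilinear[OF assms(1)]
  have \<alpha>: "\<alpha> = 2 \<or> \<alpha> = 3"
    using assms(2) by (metis exhaust_3)
  have "T z (E 1) (E 1) + T z (E 2) (E 2) - T z (E 3) (E 3) - T z (E 4) (E 4) = 0"
    using \<alpha> norden_tensorD(2)[OF assms(1,2), of z "E 1" "E 1"] norden_tensorD(2)[OF assms(1,2), of z "E 2" "E 2"]
    by (elim disjE; simp add: Jmap_basis trilinearD[OF tri])
  moreover have "2 * T (E i) (E i) z = - T z (E i) (E i)" for i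
    using cyc[of "E i" "E i" z] norden_tensorD(1)[OF assms(1,2), of "E i" "E i" z] by linarith
  from this[of 1] this[of 2] this[of 3] this[of 4] calculation show ?thesis
    unfolding lee_form_eq by linarith
qed

lemma norden_W2_iff:
  "\<alpha> \<noteq> 1 \<Longrightarrow> T \<in> basic_class \<alpha> 2 \<longleftrightarrow> T \<in> tensor_space \<alpha> \<and>
    (\<forall>x y z. cyclic_J_sum \<alpha> T x y z = 0) \<and> (\<forall>z. lee_form T z = 0)"
  by (simp add: basic_class_def basic_class_Norden_def)

lemma norden_W123:
  assumes "T \<in> tensor_space \<alpha>" "\<alpha> \<noteq> 1"
  shows "T \<in> direct_sum_class \<alpha> {1, 2, 3}"
proof -
  let ?P = "norden_trace_part \<alpha> T" and ?R = "norden_skew_part \<alpha> T"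
  let ?Q = "\<lambda>x y z. T x y z - ?P x y z - ?R x y z"
  have "lee_form ?R z = 0" for z
    using norden_cyclic_imp_trace_free[OF norden_skew_part_in_tensor_space[OF assms] assms(2)]
      norden_skew_part_cyclic[OF assms] by blast
  then have "lee_form ?Q z = 0" for z
    using lee_form_norden_trace_part[OF tensor_space_trilinear[OF assms(1)] assms(2)]
    by (simp add: lee_form_diff)
  moreover have "cyclic_J_sum \<alpha> ?Q x y z = 0" for x y z
    using norden_trace_part_nijenhuis[OF tensor_space_trilinear[OF assms(1)] assms(2), of x y z]
      norden_skew_part_nijenhuis[OF assms, of x y z] by linarith
  moreover have "?Q \<in> tensor_space \<alpha>"
    by (intro tensor_space_diff norden_trace_part_in_tensor_space norden_skew_part_in_tensor_space assms)
  ultimately have "?Q \<in> basic_class \<alpha> 2"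
    by (simp add: norden_W2_iff[OF assms(2)])
  from direct_sum_class_triple[OF norden_W1[OF assms] this norden_W3[OF assms]] show ?thesis
    by simp
qed

lemma direct_sum_class_pair_in_tensor_space:
  assumes "i \<noteq> j" "T \<in> direct_sum_class \<alpha> {i, j}"
  shows "T \<in> tensor_space \<alpha>"
proof -
  obtain P Q where PQ: "P \<in> tensor_space \<alpha>" "Q \<in> tensor_space \<alpha>" "T = (\<lambda>x y z. P x y z + Q x y z)"
    using assms unfolding direct_sum_class_pair[OF assms(1)] by (auto simp: basic_class_def)
  have "(\<lambda>x y z. 0 - Q x y z) \<in> tensor_space \<alpha>"
    by (rule tensor_space_diff[OF _ PQ(2)]) (simp add: tensor_space_def trilinear_def linear_zero)
  from tensor_space_diff[OF PQ(1) this] show ?thesis by (simp add: PQ(3))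
qed

lemma norden_W12_iff:
  assumes "\<alpha> \<noteq> 1"
  shows "T \<in> direct_sum_class \<alpha> {1, 2} \<longleftrightarrow> T \<in> tensor_space \<alpha> \<and>
    (\<forall>x y z. cyclic_J_sum \<alpha> T x y z = 0)"
proof (intro iffI conjI allI)
  assume "T \<in> direct_sum_class \<alpha> {1, 2}"
  then show "T \<in> tensor_space \<alpha>"
    by (rule direct_sum_class_pair_in_tensor_space[rotated]) simp
  fix x y z
  obtain P Q where P: "P \<in> basic_class \<alpha> 1" and Q: "Q \<in> basic_class \<alpha> 2"
    and T: "T = (\<lambda>x y z. P x y z + Q x y z)"
    using \<open>T \<in> direct_sum_class \<alpha> {1, 2}\<close> direct_sum_class_pair[of 1 2] by auto
  have "P = norden_trace_part \<alpha> P"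
    using P assms by (simp add: basic_class_def basic_class_Norden_def norden_trace_part_def fun_eq_iff)
  moreover have "trilinear P"
    using P by (auto simp: basic_class_def tensor_space_trilinear)
  ultimately have "cyclic_J_sum \<alpha> P x y z = 0"
    using norden_trace_part_nijenhuis[OF _ assms, of P x y z] by simp
  moreover have "cyclic_J_sum \<alpha> Q x y z = 0"
    using Q norden_W2_iff[OF assms] by blast
  ultimately show "cyclic_J_sum \<alpha> T x y z = 0"
    by (simp add: T)
next
  assume "T \<in> tensor_space \<alpha> \<and>
    (\<forall>x y z. cyclic_J_sum \<alpha> T x y z = 0)"
  then have T: "T \<in> tensor_space \<alpha>"
    and N: "cyclic_J_sum \<alpha> T x y z = 0" for x y z
    by blast+
  let ?P = "norden_trace_part \<alpha> T"
  let ?Q = "\<lambda>x y z. T x y z - ?P x y z"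
  have P: "?P \<in> basic_class \<alpha> 1"
    by (rule norden_W1[OF T assms])
  have "cyclic_J_sum \<alpha> ?Q x y z = 0" for x y z
    using N[of x y z] norden_trace_part_nijenhuis[OF tensor_space_trilinear[OF T] assms, of x y z]
    by linarith
  moreover have "?Q \<in> tensor_space \<alpha>"
    by (intro tensor_space_diff norden_trace_part_in_tensor_space T assms)
  ultimately have "?Q \<in> basic_class \<alpha> 2"
    using lee_form_norden_trace_part[OF tensor_space_trilinear[OF T] assms]
    unfolding norden_W2_iff[OF assms] by (simp add: lee_form_diff)
  moreover have "T = (\<lambda>x y z. ?P x y z + ?Q x y z)" by simp
  ultimately show "T \<in> direct_sum_class \<alpha> {1, 2}"
    using P direct_sum_class_pair[of 1 2 T \<alpha>] by fastforce
qed

lemma norden_W3_iff: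
  "\<alpha> \<noteq> 1 \<Longrightarrow> T \<in> basic_class \<alpha> 3 \<longleftrightarrow> T \<in> tensor_space \<alpha> \<and>
    (\<forall>x y z. cyclic_sum T x y z = 0)"
  by (simp add: basic_class_def basic_class_Norden_def)

lemma norden_W3_trace_free: "\<alpha> \<noteq> 1 \<Longrightarrow> T \<in> basic_class \<alpha> 3 \<Longrightarrow> lee_form T z = 0"
  by (rule norden_cyclic_imp_trace_free) (auto simp: norden_W3_iff)

lemma norden_W23_iff:
  assumes "\<alpha> \<noteq> 1"
  shows "T \<in> direct_sum_class \<alpha> {2, 3} \<longleftrightarrow> T \<in> tensor_space \<alpha> \<and> (\<forall>z. lee_form T z = 0)"
proof (intro iffI conjI allI)
  assume "T \<in> direct_sum_class \<alpha> {2, 3}"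
  then show "T \<in> tensor_space \<alpha>"
    by (rule direct_sum_class_pair_in_tensor_space[rotated]) simp
  fix z
  show "lee_form T z = 0"
    using \<open>T \<in> direct_sum_class \<alpha> {2, 3}\<close> norden_W3_trace_free[OF assms] direct_sum_class_pair[of 2 3]
    by (auto simp: norden_W2_iff[OF assms] lee_form_add)
next
  assume *: "T \<in> tensor_space \<alpha> \<and> (\<forall>z. lee_form T z = 0)"
  then have T: "T \<in> tensor_space \<alpha>" by blast
  let ?R = "norden_skew_part \<alpha> T"
  let ?Q = "\<lambda>x y z. T x y z - ?R x y z"
  have R: "?R \<in> basic_class \<alpha> 3"
    by (rule norden_W3[OF T assms])
  have "cyclic_J_sum \<alpha> ?Q x y z = 0" for x y z
    using norden_skew_part_nijenhuis[OF T assms, of x y z] by linarith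
  moreover have "?Q \<in> tensor_space \<alpha>"
    by (intro tensor_space_diff norden_skew_part_in_tensor_space T assms)
  ultimately have "?Q \<in> basic_class \<alpha> 2"
    using norden_W3_trace_free[OF assms R] * unfolding norden_W2_iff[OF assms] by (simp add: lee_form_diff)
  moreover have "T = (\<lambda>x y z. ?Q x y z + ?R x y z)" by simp
  ultimately show "T \<in> direct_sum_class \<alpha> {2, 3}"
    using R direct_sum_class_pair[of 2 3 T \<alpha>] by fastforce
qed

text \<open>The part in \<open>\<W>\<^sub>3\<close> has no cyclic sum and no Lee form, so the part in \<open>\<W>\<^sub>1\<close> is the trace
part of the whole tensor.\<close>

lemma norden_W13_cyclic:
  assumes "\<alpha> \<noteq> 1" "T \<in> direct_sum_class \<alpha> {1, 3}"
  shows "cyclic_sum T x y z =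
    cyclic_sum (norden_trace_part \<alpha> T) x y z"
proof -
  obtain P R where P: "P \<in> basic_class \<alpha> 1" and R: "R \<in> basic_class \<alpha> 3"
    and T: "T = (\<lambda>x y z. P x y z + R x y z)"
    using assms direct_sum_class_pair[of 1 3] by auto
  have "P x y z = norden_trace_part \<alpha> P x y z" for x y z
    using P assms by (simp add: basic_class_def basic_class_Norden_def norden_trace_part_def)
  also have "norden_trace_part \<alpha> P = norden_trace_part \<alpha> T"
    by (simp add: norden_trace_part_def fun_eq_iff T lee_form_add norden_W3_trace_free[OF assms(1) R])
  finally have P': "P x y z = norden_trace_part \<alpha> T x y z" for x y z .
  have T': "T x y z = norden_trace_part \<alpha> T x y z + R x y z" for x y z
    unfolding P'[symmetric] by (simp only: T)
  have "cyclic_sum R x y z = 0"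
    using R norden_W3_iff[OF assms(1)] by blast
  then show ?thesis
    using T'[of x y z] T'[of y z x] T'[of z x y] by linarith
qed

text \<open>The condition on \<open>i\<close> lists the indices of the classes that exist for \<open>J\<^sub>\<alpha>\<close>; for other indices the
class is empty.\<close>

lemma zero_in_basic_class: "i \<in> (if \<alpha> = 1 then {0,2,4} else {0,1,2,3}) \<Longrightarrow> (\<lambda>_ _ _. 0) \<in> basic_class \<alpha> i"
  by (auto simp: basic_class_def basic_class_J1_def basic_class_Norden_def lee_form_eq
     tensor_space_def trilinear_def linear_zero split: if_splits)

lemma direct_sum_class_mono:
  assumes "I \<subseteq> I'" "I' \<subseteq> (if \<alpha> = 1 then {0,2,4} else {0,1,2,3})"
  shows "direct_sum_class \<alpha> I \<subseteq> direct_sum_class \<alpha> I'"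
proof
  fix T assume "T \<in> direct_sum_class \<alpha> I"
  then obtain D where D: "T = (\<lambda>x y z. \<Sum>i\<in>I. D i x y z)" "\<forall>i\<in>I. D i \<in> basic_class \<alpha> i"
    unfolding direct_sum_class_def by blast
  \<comment> \<open>Pad the decomposition by zero tensors.\<close>
  let ?D = "\<lambda>i. if i \<in> I then D i else (\<lambda>_ _ _. 0)"
  have "finite I'"
    using assms(2) by (rule finite_subset) simp
  then have "T = (\<lambda>x y z. \<Sum>i\<in>I'. ?D i x y z)"
    using assms(1) unfolding D(1) by (intro ext sum.mono_neutral_cong_left) auto
  moreover have "\<forall>i\<in>I'. ?D i \<in> basic_class \<alpha> i"
    using D(2) zero_in_basic_class assms(2) by auto
  ultimately show "T \<in> direct_sum_class \<alpha> I'"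
    unfolding direct_sum_class_def by (intro CollectI exI[of _ ?D] conjI)
qed

lemma norden_W1_iff:
  "\<alpha> \<noteq> 1 \<Longrightarrow> T \<in> basic_class \<alpha> 1 \<longleftrightarrow> T \<in> tensor_space \<alpha> \<and>
    (\<forall>x y z. T x y z = norden_trace_part \<alpha> T x y z)"
  by (simp add: basic_class_def basic_class_Norden_def norden_trace_part_def)

lemma direct_sum_class_0_subset:
  assumes "i \<in> (if \<alpha> = 1 then {0,2,4} else {0,1,2,3})"
  shows "direct_sum_class \<alpha> {0} \<subseteq> direct_sum_class \<alpha> {i}"
  using assms unfolding direct_sum_class_single
  by (auto simp: basic_class_def basic_class_J1_def basic_class_Norden_def lee_form_eq split: if_splits)

lemma hermitian_not_W0: "T \<notin> direct_sum_class 1 {2} \<Longrightarrow> T \<notin> direct_sum_class 1 {0}"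
  using direct_sum_class_0_subset[of 2 1] by auto

lemma norden_not_W0: "\<alpha> \<noteq> 1 \<Longrightarrow> T \<notin> direct_sum_class \<alpha> {3} \<Longrightarrow> T \<notin> direct_sum_class \<alpha> {0}"
  using direct_sum_class_0_subset[of 3 \<alpha>] by auto

lemma norden_not_W1_W3:
  assumes "\<alpha> \<noteq> 1" "T \<notin> direct_sum_class \<alpha> {1, 3}"
  shows "T \<notin> direct_sum_class \<alpha> {1}" "T \<notin> direct_sum_class \<alpha> {3}"
  using assms direct_sum_class_mono[of "{1}" "{1, 3}" \<alpha>] direct_sum_class_mono[of "{3}" "{1, 3}" \<alpha>] by auto

lemma norden_not_W2:
  assumes "\<alpha> \<noteq> 1" "T \<notin> direct_sum_class \<alpha> {2, 3}"
  shows "T \<notin> direct_sum_class \<alpha> {2}"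
  using assms direct_sum_class_mono[of "{2}" "{2, 3}" \<alpha>] by auto

lemma hermitian_not_W2I: "cyclic_sum T x y z \<noteq> 0 \<Longrightarrow> T \<notin> direct_sum_class 1 {2}"
  by (auto simp: direct_sum_class_single basic_class_def basic_class_J1_def)

lemma hermitian_not_W4I:
  "T x y z \<noteq> hermitian_trace_part T x y z \<Longrightarrow> T \<notin> direct_sum_class 1 {4}"
  unfolding direct_sum_class_single basic_class_def basic_class_J1_def hermitian_trace_part_def by auto

lemma norden_not_W12I:
  "\<alpha> \<noteq> 1 \<Longrightarrow> cyclic_J_sum \<alpha> T x y z \<noteq> 0 \<Longrightarrow> T \<notin> direct_sum_class \<alpha> {1, 2}"
  using norden_W12_iff by blast

lemma norden_not_W13I:
  "\<alpha> \<noteq> 1 \<Longrightarrow> cyclic_sum T x y z \<noteq> cyclic_sum (norden_trace_part \<alpha> T) x y z \<Longrightarrow>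
    T \<notin> direct_sum_class \<alpha> {1, 3}"
  using norden_W13_cyclic by blast

lemma norden_not_W23I: "\<alpha> \<noteq> 1 \<Longrightarrow> lee_form T z \<noteq> 0 \<Longrightarrow> T \<notin> direct_sum_class \<alpha> {2, 3}"
  using norden_W23_iff by blast

section \<open>The fundamental tensors of a Lie algebra\<close>

text \<open>Summing over the table of brackets makes bilinearity and skew symmetry immediate and lets the
simplifier expand the bracket of a concrete Lie algebra directly.\<close>

definition alg_bracket :: "lie_alg \<Rightarrow> real^4 \<Rightarrow> real^4 \<Rightarrow> real^4" where
  "alg_bracket l x y = (\<Sum>((i, j), v)\<leftarrow>brackets l. (x$i * y$j - x$j * y$i) *\<^sub>R v)"

lemma bilinear_alg_bracket: "bilinear (alg_bracket l)"
proof -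
  have "bilinear (\<lambda>x y. \<Sum>((i, j), v)\<leftarrow>t. (x$i * y$j - x$j * y$i) *\<^sub>R v)" for t :: "((4 \<times> 4) \<times> (real^4)) list"
    by (induction t)
       (auto simp: bilinear_def linear_iff algebra_simps split: prod.splits)
  then show ?thesis unfolding alg_bracket_def .
qed

lemma alg_bracket_antisym: "alg_bracket l y x = - alg_bracket l x y"
proof -
  have "(\<Sum>((i, j), v)\<leftarrow>t. (y$i * x$j - y$j * x$i) *\<^sub>R v) =
      - (\<Sum>((i, j), v)\<leftarrow>t. (x$i * y$j - x$j * y$i) *\<^sub>R v)" for t :: "((4 \<times> 4) \<times> (real^4)) list"
    by (induction t) (auto simp: algebra_simps split: prod.splits)
  then show ?thesis unfolding alg_bracket_def .
qed

lemma alg_bracket_basis: "alg_bracket l (E i) (E j) = bracket l i j"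
proof -
  have "\<forall>i j. alg_bracket l (E i) (E j) = bracket l i j"
    by (cases l) (simp_all add: forall_4 alg_bracket_def bracket_def axis_def)
  then show ?thesis by blast
qed

text \<open>The Koszul formula for \<open>g(\<nabla>\<^sub>x y, z)\<close> on left-invariant fields; the three derivative terms are absent
because the metric is constant on them.\<close>

definition koszul_form :: "lie_alg \<Rightarrow> tensor3" where
  "koszul_form l x y z = 1/2 * (hn_metric (alg_bracket l x y) z - hn_metric (alg_bracket l y z) x
     + hn_metric (alg_bracket l z x) y)"

lemma koszul_form_skew: "koszul_form l x z y = - koszul_form l x y z"
  by (simp add: koszul_form_def alg_bracket_antisym[of l y x] alg_bracket_antisym[of l z x]
      alg_bracket_antisym[of l z y] bilinear_lneg[OF bilinear_hn_metric] field_simps)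

lemma trilinear_koszul_form: "trilinear (koszul_form l)"
  unfolding trilinear_def koszul_form_def linear_iff
  by (simp add: algebra_simps
      bilinear_ladd[OF bilinear_alg_bracket] bilinear_radd[OF bilinear_alg_bracket]
      bilinear_lmul[OF bilinear_alg_bracket] bilinear_rmul[OF bilinear_alg_bracket]
      bilinear_ladd[OF bilinear_hn_metric] bilinear_radd[OF bilinear_hn_metric]
      bilinear_lmul[OF bilinear_hn_metric] bilinear_rmul[OF bilinear_hn_metric])

definition F_tensor :: "lie_alg \<Rightarrow> 3 \<Rightarrow> tensor3" where
  "F_tensor l \<alpha> x y z = koszul_form l x (Jmap \<alpha> y) z + eps \<alpha> * koszul_form l x y (Jmap \<alpha> z)"

text \<open>The symmetries come from the Koszul form being skew in its last two arguments and from \<open>J\<^sup>2 = -1\<close>.\<close>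

lemma F_tensor_in_tensor_space: "F_tensor l \<alpha> \<in> tensor_space \<alpha>"
proof -
  have "trilinear (F_tensor l \<alpha>)"
    unfolding trilinear_def F_tensor_def linear_iff
    by (simp add: algebra_simps trilinearD[OF trilinear_koszul_form]
        linear_add[OF linear_Jmap] linear_scale[OF linear_Jmap])
  moreover have "F_tensor l \<alpha> x y z = - eps \<alpha> * F_tensor l \<alpha> x z y" for x y z
    using koszul_form_skew[of l x "Jmap \<alpha> y" z] koszul_form_skew[of l x "Jmap \<alpha> z" y]
    by (simp add: F_tensor_def eps_def algebra_simps)
  moreover have "F_tensor l \<alpha> x y z = - eps \<alpha> * F_tensor l \<alpha> x (Jmap \<alpha> y) (Jmap \<alpha> z)" for x y z
    by (simp add: F_tensor_def Jmap_Jmap eps_def trilinearD[OF trilinear_koszul_form])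
  ultimately show ?thesis unfolding tensor_space_def by blast
qed

section \<open>Reduction from the Lie group to its Lie algebra\<close>

lemma Ck_on_const: "Ck_on k S (\<lambda>_. c)"
  by (induction k arbitrary: c) auto

lemma smooth_fun_const: "smooth_fun A (\<lambda>_. c)"
  by (auto simp: smooth_fun_def smooth_on_def comp_def Ck_on_const)

text \<open>The Leibniz rule for \<open>1 = 1 * 1\<close> gives \<open>X 1 = 2 X 1\<close>.\<close>

lemma vector_field_const:
  assumes "vector_field A X" shows "X (\<lambda>_. c) = (\<lambda>_. 0)"
proof -
  have "X (\<lambda>q. 1 * 1) = (\<lambda>q. 1 * X (\<lambda>_. 1) q + 1 * X (\<lambda>_. 1) q)"
    using assms smooth_fun_const[of A 1] unfolding vector_field_def by blast
  then have "X (\<lambda>_. 1) = (\<lambda>_. 0)" by (simp add: fun_eq_iff)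
  moreover have "X (\<lambda>q. c * 1) = (\<lambda>q. c * X (\<lambda>_. 1) q)"
    using assms smooth_fun_const[of A 1] unfolding vector_field_def by blast
  ultimately show ?thesis by simp
qed

lemma comb_add: "comb e (x + y) = vadd (comb e x) (comb e y)"
  by (simp add: comb_def vadd_def fun_eq_iff algebra_simps sum.distrib)

lemma comb_scale: "comb e (c *\<^sub>R x) = vscale (\<lambda>_. c) (comb e x)"
  by (simp add: comb_def vscale_def fun_eq_iff sum_distrib_left mult.assoc)

lemma comb_basis: "comb e (E i) = e i"
  by (simp add: comb_def fun_eq_iff axis_def if_distrib[of "\<lambda>c. c * _"] cong: if_cong)

lemma linear_comb: "linear (\<lambda>x. comb e x f q)"
  by (simp add: linear_iff comb_add comb_scale vadd_def vscale_def)

context hypercomplex_HN_lie_group begin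

lemma vector_field_comb [simp]: "vector_field A (comb e x)"
  using basis bij_betwE left_invariant_def by blast

lemma lie_bracket_comb: "lie_bracket (comb e x) (comb e y) = comb e (alg_bracket l x y)"
proof (intro ext)
  fix f q
  show "lie_bracket (comb e x) (comb e y) f q = comb e (alg_bracket l x y) f q"
  proof (cases "smooth_fun A f")
    \<comment> \<open>Vector fields vanish by convention on functions that are not smooth, so both sides are zero.\<close>
    case False
    then have "comb e x f = (\<lambda>_. 0)" for x
      using vector_field_comb[of x] unfolding vector_field_def by blast
    then show ?thesis
      by (simp add: lie_bracket_def vector_field_const[OF vector_field_comb])
  next
    case True
    have smooth: "smooth_fun A (comb e x f)" for x
      using True vector_field_comb[of x] unfolding vector_field_def by blast
    have add: "comb e z (comb e (x + y) f) q = comb e z (comb e x f) q + comb e z (comb e y f) q" for x y z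
      using vector_field_comb[of z] smooth[of x] smooth[of y]
      unfolding vector_field_def comb_add vadd_def by simp
    have scale: "comb e z (comb e (c *\<^sub>R x) f) q = c * comb e z (comb e x f) q" for c x z
      using vector_field_comb[of z] smooth[of x]
      unfolding vector_field_def comb_scale vscale_def by simp
    have "bilinear (\<lambda>x y. comb e x (comb e y f) q)"
      by (simp add: bilinear_def linear_comb linear_iff add scale)
    then have "bilinear (\<lambda>x y. lie_bracket (comb e x) (comb e y) f q)"
      unfolding lie_bracket_def bilinear_def linear_iff by (simp add: algebra_simps)
    moreover have "bilinear (\<lambda>x y. comb e (alg_bracket l x y) f q)"
      using bilinear_alg_bracket[of l] linear_comb[of e f q]
      unfolding bilinear_def linear_iff by simp
    moreover have "lie_bracket (comb e a) (comb e b) f q = comb e (alg_bracket l a b) f q"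
      if ab: "a \<in> Basis" "b \<in> Basis" for a b
    proof -
      obtain i j where "a = E i" "b = E j"
        using ab axis_inverse[of a] axis_inverse[of b] by auto
      then show ?thesis
        by (simp add: comb_basis bracket_eq alg_bracket_basis)
    qed
    ultimately show ?thesis
      by (rule bilinear_eq_stdbasis[THEN fun_cong, THEN fun_cong])
  qed
qed

lemma vector_field_J: "vector_field A X \<Longrightarrow> vector_field A (J \<alpha> X)"
  using J_endo unfolding endomorphism_field_def by blast

lemma vector_field_N: "vector_field A X \<Longrightarrow> vector_field A Y \<Longrightarrow> vector_field A (N X Y)"
  using levi_civita unfolding levi_civita_def affine_connection_def by blast

lemma g_sym: "vector_field A X \<Longrightarrow> vector_field A Y \<Longrightarrow> g X Y = g Y X"
  using g_metric unfolding pseudo_riemannian_def by blast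

lemma g_uminus:
  assumes "vector_field A X" "vector_field A Z"
  shows "g (vscale (\<lambda>_. -1) X) Z = (\<lambda>q. - g X Z q)"
proof -
  have "\<forall>h X Y. smooth_fun A h \<longrightarrow> vector_field A X \<longrightarrow> vector_field A Y \<longrightarrow>
        g (vscale h X) Y = (\<lambda>q. h q * g X Y q)"
    using g_metric unfolding pseudo_riemannian_def by (elim conjE)
  then show ?thesis using assms smooth_fun_const[of A "-1"] by simp
qed

lemma g_vdiff:
  assumes "vector_field A X" "vector_field A Y" "vector_field A Z"
  shows "g (vdiff X Y) Z q = g X Z q - g Y Z q"
proof -
  have add: "\<forall>X Y Z. vector_field A X \<longrightarrow> vector_field A Y \<longrightarrow> vector_field A Z \<longrightarrow>
        g (vadd X Y) Z = (\<lambda>q. g X Z q + g Y Z q)"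
    using g_metric unfolding pseudo_riemannian_def by (elim conjE)
  \<comment> \<open>\<open>- Y\<close> is a vector field because it equals \<open>J (J Y)\<close>.\<close>
  have "vector_field A (vscale (\<lambda>_. -1) Y)"
    using J_square[of Y 1] vector_field_J[of _ 1] assms(2) by metis
  moreover have "vdiff X Y = vadd X (vscale (\<lambda>_. -1) Y)"
    by (simp add: vdiff_def vadd_def vscale_def)
  ultimately show ?thesis
    using add assms by (simp add: g_uminus)
qed

text \<open>The classical argument: torsion-freeness at the three cyclic permutations of \<open>x\<close>, \<open>y\<close>, \<open>z\<close>, together
with the compatibility of the connection with the metric, whose left side is the derivative of a constant.\<close>

lemma koszul_formula: "g (N (comb e x) (comb e y)) (comb e z) q = koszul_form l x y z"
proof -
  let ?G = "\<lambda>x y z. g (N (comb e x) (comb e y)) (comb e z) q"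
  have torsion: "?G x y z - ?G y x z = hn_metric (alg_bracket l x y) z" for x y z
  proof -
    have "vdiff (N (comb e x) (comb e y)) (N (comb e y) (comb e x)) = comb e (alg_bracket l x y)"
      using levi_civita unfolding levi_civita_def by (simp add: lie_bracket_comb)
    then show ?thesis
      using g_vdiff[of "N (comb e x) (comb e y)" "N (comb e y) (comb e x)" "comb e z" q]
      by (simp add: vector_field_N g_values)
  qed
  have metric: "?G x y z + ?G x z y = 0" for x y z
  proof -
    have "comb e x (g (comb e y) (comb e z)) =
        (\<lambda>q. g (N (comb e x) (comb e y)) (comb e z) q + g (comb e y) (N (comb e x) (comb e z)) q)"
      using levi_civita unfolding levi_civita_def by simp
    then show ?thesis
      using g_sym[of "comb e y" "N (comb e x) (comb e z)"]
      by (simp add: g_values vector_field_const[OF vector_field_comb] vector_field_N fun_eq_iff)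
  qed
  show ?thesis
    using torsion[of x y z] torsion[of y z x] torsion[of z x y]
      metric[of x y z] metric[of y x z] metric[of z x y]
    by (simp add: koszul_form_def)
qed

text \<open>The term \<open>g(J (\<nabla>\<^sub>x y), z)\<close> is not directly accessible to the Koszul formula; compatibility of \<open>g\<close> with
\<open>J\<close> moves \<open>J\<close> to the left-invariant field \<open>z\<close>.\<close>

lemma fundamental_tensor_eq:
  "fundamental_tensor g N (J \<alpha>) (comb e x) (comb e y) (comb e z) q = F_tensor l \<alpha> x y z"
proof -
  let ?V = "N (comb e x) (comb e y)"
  have V: "vector_field A ?V" by (simp add: vector_field_N)
  have "g (J \<alpha> ?V) (comb e z) q = eps \<alpha> * g (J \<alpha> (J \<alpha> ?V)) (J \<alpha> (comb e z)) q"
    using g_compatible[of "J \<alpha> ?V" "comb e z" \<alpha>] V by (simp add: vector_field_J)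
  also have "\<dots> = - eps \<alpha> * g ?V (comb e (Jmap \<alpha> z)) q"
    by (simp add: J_square[OF V] J_values g_uminus[OF V])
  finally show ?thesis
    by (simp add: fundamental_tensor_def J_values g_vdiff vector_field_N vector_field_J V
        koszul_formula F_tensor_def)
qed

lemma in_class_iff: "in_class e J g N \<alpha> I \<longleftrightarrow> F_tensor l \<alpha> \<in> direct_sum_class \<alpha> I"
proof -
  have "(\<lambda>x y z. F_tensor l \<alpha> x y z) = F_tensor l \<alpha>" by simp
  then show ?thesis by (simp add: in_class_def fundamental_tensor_eq)
qed

end

section \<open>The classes of the individual Lie algebras\<close>

text \<open>Rewriting with these facts turns the value of a fundamental tensor into a polynomial in the coordinates of
its arguments and the parameters of the Lie algebra.\<close>

lemmas F_eval = F_tensor_def koszul_form_def alg_bracket_def Jmap_def hn_metric_def eps_def axis_def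

text \<open>The largest direct sums contain every tensor with the required symmetries, whatever the Lie algebra.\<close>

lemma generic_classes:
  "F_tensor l 1 \<in> direct_sum_class 1 {2, 4}"
  "F_tensor l 2 \<in> direct_sum_class 2 {1, 2, 3}"
  "F_tensor l 3 \<in> direct_sum_class 3 {1, 2, 3}"
  by (rule hermitian_W24 norden_W123; simp add: F_tensor_in_tensor_space)+

text \<open>The remaining memberships.  Parameter values are hypotheses in the form of equations, so that the
statements can be applied to any description of the same case.  The simplifier writes the class index
\<open>1\<close> as \<open>Suc 0\<close>, which is why some criteria below are unfolded accordingly.\<close>

lemma G42_J1_W4: "m = 1 \<Longrightarrow> F_tensor (G42 m) 1 \<in> direct_sum_class 1 {4}"
  by (rule hermitian_W4I[OF F_tensor_in_tensor_space])
     (simp add: forall_4 F_eval hermitian_trace_part_def lee_form_eq)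

lemma G45_J1_W2: "a1 = -1 \<Longrightarrow> F_tensor (G45 a1 a2) 1 \<in> direct_sum_class 1 {2}"
  unfolding hermitian_W2_iff[OF F_tensor_in_tensor_space]
  by (simp add: F_eval) (simp add: field_simps)

lemma G45_J1_W4: "a1 = 1 \<Longrightarrow> F_tensor (G45 a1 a2) 1 \<in> direct_sum_class 1 {4}"
  by (rule hermitian_W4I[OF F_tensor_in_tensor_space])
     (simp add: forall_4 F_eval hermitian_trace_part_def lee_form_eq)

lemma G45_J2_W1: "a1 = 1 \<Longrightarrow> a2 = 1 \<Longrightarrow> F_tensor (G45 a1 a2) 2 \<in> direct_sum_class 2 {1}"
  by (simp add: direct_sum_class_single norden_W1_iff[unfolded One_nat_def] F_tensor_in_tensor_space)
     (simp add: F_eval norden_trace_part_def lee_form_eq field_simps)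

lemma G45_J2_W2: "a1 = -1 \<Longrightarrow> a2 = 1 \<Longrightarrow> F_tensor (G45 a1 a2) 2 \<in> direct_sum_class 2 {2}"
  by (simp add: direct_sum_class_single norden_W2_iff F_tensor_in_tensor_space)
     (simp add: F_eval lee_form_eq field_simps)

lemma G45_J2_W12: "a2 = 1 \<Longrightarrow> F_tensor (G45 a1 a2) 2 \<in> direct_sum_class 2 {1, 2}"
  by (simp add: norden_W12_iff[unfolded One_nat_def] F_tensor_in_tensor_space)
     (simp add: F_eval field_simps)

lemma G45_J2_W23: "a1 = - 1/2 * (a2 + 1) \<Longrightarrow> F_tensor (G45 a1 a2) 2 \<in> direct_sum_class 2 {2, 3}"
  by (simp add: norden_W23_iff F_tensor_in_tensor_space)
     (simp add: F_eval lee_form_eq field_simps)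

lemma G45_J3_W2: "a1 = -1 \<Longrightarrow> a2 = -1 \<Longrightarrow> F_tensor (G45 a1 a2) 3 \<in> direct_sum_class 3 {2}"
  by (simp add: direct_sum_class_single norden_W2_iff F_tensor_in_tensor_space)
     (simp add: F_eval lee_form_eq field_simps)

lemma G45_J3_W12: "a1 = a2 \<Longrightarrow> F_tensor (G45 a1 a2) 3 \<in> direct_sum_class 3 {1, 2}"
  by (simp add: norden_W12_iff[unfolded One_nat_def] F_tensor_in_tensor_space)
     (simp add: F_eval field_simps)

lemma G45_J3_W23: "a1 = - a2 - 2 \<Longrightarrow> F_tensor (G45 a1 a2) 3 \<in> direct_sum_class 3 {2, 3}"
  by (simp add: norden_W23_iff F_tensor_in_tensor_space)
     (simp add: F_eval lee_form_eq field_simps)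

lemma G46_J3_W12: "F_tensor (G46 b1 b2) 3 \<in> direct_sum_class 3 {1, 2}"
  by (simp add: norden_W12_iff[unfolded One_nat_def] F_tensor_in_tensor_space)
     (simp add: F_eval field_simps)

lemma G47_J1_W4: "F_tensor G47 1 \<in> direct_sum_class 1 {4}"
  by (rule hermitian_W4I[OF F_tensor_in_tensor_space])
     (simp add: forall_4 F_eval hermitian_trace_part_def lee_form_eq)

lemma G48_J3_W3: "F_tensor G48 3 \<in> direct_sum_class 3 {3}"
  by (simp add: direct_sum_class_single norden_W3_iff F_tensor_in_tensor_space)
     (simp add: F_eval field_simps)

lemma G49_J1_W4: "p = 1 \<Longrightarrow> F_tensor (G49 p) 1 \<in> direct_sum_class 1 {4}"
  by (rule hermitian_W4I[OF F_tensor_in_tensor_space])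
     (simp add: forall_4 F_eval hermitian_trace_part_def lee_form_eq)

lemma G49_J2_W12: "F_tensor (G49 p) 2 \<in> direct_sum_class 2 {1, 2}"
  by (simp add: norden_W12_iff[unfolded One_nat_def] F_tensor_in_tensor_space)
     (simp add: F_eval field_simps)

lemma G49_J3_W12: "p = 1 \<Longrightarrow> F_tensor (G49 p) 3 \<in> direct_sum_class 3 {1, 2}"
  by (simp add: norden_W12_iff[unfolded One_nat_def] F_tensor_in_tensor_space)
     (simp add: F_eval field_simps)

lemma G411_J3_W12: "F_tensor (G411 q) 3 \<in> direct_sum_class 3 {1, 2}"
  by (simp add: norden_W12_iff[unfolded One_nat_def] F_tensor_in_tensor_space)
     (simp add: F_eval field_simps)

lemma G412_J1_W4: "F_tensor G412 1 \<in> direct_sum_class 1 {4}"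
  by (rule hermitian_W4I[OF F_tensor_in_tensor_space])
     (simp add: forall_4 F_eval hermitian_trace_part_def lee_form_eq)

text \<open>The exclusions for \<open>g\<^sub>4\<^sub>5\<close>.  At the chosen basis vectors the tensor, respectively its cyclic sum, is a
nonzero constant that does not depend on \<open>a1\<close> and \<open>a2\<close>.\<close>

lemma G45_J1_not_W0: "F_tensor (G45 a1 a2) 1 \<notin> direct_sum_class 1 {0}"
proof
  assume "F_tensor (G45 a1 a2) 1 \<in> direct_sum_class 1 {0}"
  then have "F_tensor (G45 a1 a2) 1 (E 1) (E 1) (E 3) = 0"
    by (simp add: direct_sum_class_single basic_class_def basic_class_J1_def)
  then show False by (simp add: F_eval)
qed

lemma G45_J2_not_W3: "F_tensor (G45 a1 a2) 2 \<notin> direct_sum_class 2 {3}"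
proof
  assume "F_tensor (G45 a1 a2) 2 \<in> direct_sum_class 2 {3}"
  then have "cyclic_sum (F_tensor (G45 a1 a2) 2) (E 1) (E 1) (E 2) = 0"
    unfolding direct_sum_class_single norden_W3_iff[OF Norden_index(1)] by blast
  then show False by (simp add: F_eval)
qed

lemma G45_J3_not_W3: "F_tensor (G45 a1 a2) 3 \<notin> direct_sum_class 3 {3}"
proof
  assume "F_tensor (G45 a1 a2) 3 \<in> direct_sum_class 3 {3}"
  then have "cyclic_sum (F_tensor (G45 a1 a2) 3) (E 1) (E 1) (E 1) = 0"
    unfolding direct_sum_class_single norden_W3_iff[OF Norden_index(2)] by blast
  then show False by (simp add: F_eval)
qed

text \<open>No single triple of basis vectors excludes \<open>\<W>\<^sub>1\<^sub>3\<close> for all parameters; two triples give two independent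
linear equations whose only common solution is \<open>a1 = a2 = 1\<close>.\<close>

lemma G45_J2_not_W13:
  assumes "(a1, a2) \<noteq> (1, 1)"
  shows "F_tensor (G45 a1 a2) 2 \<notin> direct_sum_class 2 {1, 3}"
proof
  assume "F_tensor (G45 a1 a2) 2 \<in> direct_sum_class 2 {1, 3}"
  then have *: "cyclic_sum (F_tensor (G45 a1 a2) 2) x y z =
      cyclic_sum (norden_trace_part 2 (F_tensor (G45 a1 a2) 2)) x y z" for x y z
    by (rule norden_W13_cyclic[rotated]) simp
  have "2 * a1 + a2 = 3"
    using *[of "E 1" "E 1" "E 2"] by (simp add: F_eval norden_trace_part_def lee_form_eq field_simps)
  moreover have "2 * a1 - a2 = 1"
    using *[of "E 1" "E 3" "E 4"] by (simp add: F_eval norden_trace_part_def lee_form_eq field_simps)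
  ultimately show False
    using assms by simp
qed

lemma G45_J3_not_W13:
  assumes "(a1, a2) \<noteq> (1, 1)"
  shows "F_tensor (G45 a1 a2) 3 \<notin> direct_sum_class 3 {1, 3}"
proof
  assume "F_tensor (G45 a1 a2) 3 \<in> direct_sum_class 3 {1, 3}"
  then have *: "cyclic_sum (F_tensor (G45 a1 a2) 3) x y z =
      cyclic_sum (norden_trace_part 3 (F_tensor (G45 a1 a2) 3)) x y z" for x y z
    by (rule norden_W13_cyclic[rotated]) simp
  have "a1 + a2 = 2"
    using *[of "E 1" "E 1" "E 1"] by (simp add: F_eval norden_trace_part_def lee_form_eq field_simps)
  moreover have "3 * a1 - a2 = 2"
    using *[of "E 1" "E 2" "E 2"] by (simp add: F_eval norden_trace_part_def lee_form_eq field_simps)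
  ultimately show False
    using assms by simp
qed

text \<open>The exclusions for the families with parameters \<open>m\<close>, \<open>(b1, b2)\<close> and \<open>q\<close>.  The basis vectors are
chosen such that the defect of the equation in question is a nonzero constant, independent of the
parameters.\<close>

lemma G42_J1_not_W2: "F_tensor (G42 m) 1 \<notin> direct_sum_class 1 {2}"
  by (rule hermitian_not_W2I[where x = "E 1" and y = "E 3" and z = "E 4"])
     (simp add: F_eval)

lemma G42_J2_not_W12: "F_tensor (G42 m) 2 \<notin> direct_sum_class 2 {1, 2}"
  by (rule norden_not_W12I[OF Norden_index(1), where x = "E 2" and y = "E 3" and z = "E 4"])
     (simp add: F_eval)

lemma G42_J2_not_W13: "F_tensor (G42 m) 2 \<notin> direct_sum_class 2 {1, 3}"
  by (rule norden_not_W13I[OF Norden_index(1), where x = "E 1" and y = "E 1" and z = "E 3"])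
     (simp add: F_eval norden_trace_part_def lee_form_eq)

lemma G42_J2_not_W23: "F_tensor (G42 m) 2 \<notin> direct_sum_class 2 {2, 3}"
  by (rule norden_not_W23I[OF Norden_index(1), where z = "E 3"])
     (simp add: F_eval lee_form_eq)

lemma G42_J3_not_W12: "F_tensor (G42 m) 3 \<notin> direct_sum_class 3 {1, 2}"
  by (rule norden_not_W12I[OF Norden_index(2), where x = "E 2" and y = "E 3" and z = "E 4"])
     (simp add: F_eval)

lemma G42_J3_not_W13: "F_tensor (G42 m) 3 \<notin> direct_sum_class 3 {1, 3}"
  by (rule norden_not_W13I[OF Norden_index(2), where x = "E 1" and y = "E 1" and z = "E 4"])
     (simp add: F_eval norden_trace_part_def lee_form_eq)

lemma G42_J3_not_W23: "F_tensor (G42 m) 3 \<notin> direct_sum_class 3 {2, 3}"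
  by (rule norden_not_W23I[OF Norden_index(2), where z = "E 4"])
     (simp add: F_eval lee_form_eq)

lemma G46_J1_not_W2: "F_tensor (G46 b1 b2) 1 \<notin> direct_sum_class 1 {2}"
  by (rule hermitian_not_W2I[where x = "E 1" and y = "E 3" and z = "E 4"])
     (simp add: F_eval)

lemma G46_J1_not_W4: "F_tensor (G46 b1 b2) 1 \<notin> direct_sum_class 1 {4}"
  by (rule hermitian_not_W4I[where x = "E 3" and y = "E 1" and z = "E 4"])
     (simp add: F_eval hermitian_trace_part_def lee_form_eq)

lemma G46_J2_not_W12: "F_tensor (G46 b1 b2) 2 \<notin> direct_sum_class 2 {1, 2}"
  by (rule norden_not_W12I[OF Norden_index(1), where x = "E 2" and y = "E 3" and z = "E 4"])
     (simp add: F_eval)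

lemma G46_J2_not_W13: "F_tensor (G46 b1 b2) 2 \<notin> direct_sum_class 2 {1, 3}"
  by (rule norden_not_W13I[OF Norden_index(1), where x = "E 1" and y = "E 1" and z = "E 3"])
     (simp add: F_eval norden_trace_part_def lee_form_eq)

lemma G46_J2_not_W23: "F_tensor (G46 b1 b2) 2 \<notin> direct_sum_class 2 {2, 3}"
  by (rule norden_not_W23I[OF Norden_index(1), where z = "E 3"])
     (simp add: F_eval lee_form_eq)

lemma G46_J3_not_W13: "F_tensor (G46 b1 b2) 3 \<notin> direct_sum_class 3 {1, 3}"
  by (rule norden_not_W13I[OF Norden_index(2), where x = "E 3" and y = "E 3" and z = "E 4"])
     (simp add: F_eval norden_trace_part_def lee_form_eq)

lemma G46_J3_not_W23: "F_tensor (G46 b1 b2) 3 \<notin> direct_sum_class 3 {2, 3}"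
  by (rule norden_not_W23I[OF Norden_index(2), where z = "E 4"])
     (simp add: F_eval lee_form_eq)

lemma G411_J1_not_W2: "F_tensor (G411 q) 1 \<notin> direct_sum_class 1 {2}"
  by (rule hermitian_not_W2I[where x = "E 1" and y = "E 3" and z = "E 4"])
     (simp add: F_eval)

lemma G411_J1_not_W4: "F_tensor (G411 q) 1 \<notin> direct_sum_class 1 {4}"
  by (rule hermitian_not_W4I[where x = "E 3" and y = "E 1" and z = "E 4"])
     (simp add: F_eval hermitian_trace_part_def lee_form_eq)

lemma G411_J2_not_W12: "F_tensor (G411 q) 2 \<notin> direct_sum_class 2 {1, 2}"
  by (rule norden_not_W12I[OF Norden_index(1), where x = "E 2" and y = "E 3" and z = "E 4"])
     (simp add: F_eval)

lemma G411_J2_not_W13: "F_tensor (G411 q) 2 \<notin> direct_sum_class 2 {1, 3}"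
  by (rule norden_not_W13I[OF Norden_index(1), where x = "E 1" and y = "E 1" and z = "E 3"])
     (simp add: F_eval norden_trace_part_def lee_form_eq)

lemma G411_J2_not_W23: "F_tensor (G411 q) 2 \<notin> direct_sum_class 2 {2, 3}"
  by (rule norden_not_W23I[OF Norden_index(1), where z = "E 3"])
     (simp add: F_eval lee_form_eq)

lemma G411_J3_not_W13: "F_tensor (G411 q) 3 \<notin> direct_sum_class 3 {1, 3}"
  by (rule norden_not_W13I[OF Norden_index(2), where x = "E 3" and y = "E 3" and z = "E 4"])
     (simp add: F_eval norden_trace_part_def lee_form_eq)

lemma G411_J3_not_W23: "F_tensor (G411 q) 3 \<notin> direct_sum_class 3 {2, 3}"
  by (rule norden_not_W23I[OF Norden_index(2), where z = "E 4"])
     (simp add: F_eval lee_form_eq)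

text \<open>For the family with parameter \<open>p\<close> the defects are multiples of \<open>p + 1\<close> or \<open>p + 2\<close>, and both are positive
for \<open>p > -1\<close>.\<close>

lemma G49_J1_not_W2:
  assumes "-1 < p"
  shows "F_tensor (G49 p) 1 \<notin> direct_sum_class 1 {2}"
proof (rule hermitian_not_W2I[where x = "E 1" and y = "E 2" and z = "E 4"])
  have "cyclic_sum (F_tensor (G49 p) 1) (E 1) (E 2) (E 4) = p + 2"
    by (simp add: F_eval field_simps)
  then show "cyclic_sum (F_tensor (G49 p) 1) (E 1) (E 2) (E 4) \<noteq> 0"
    using assms by linarith
qed

lemma G49_J2_not_W13:
  assumes "-1 < p"
  shows "F_tensor (G49 p) 2 \<notin> direct_sum_class 2 {1, 3}"
proof (rule norden_not_W13I[OF Norden_index(1), where x = "E 1" and y = "E 1" and z = "E 2"])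
  have "cyclic_sum (F_tensor (G49 p) 2) (E 1) (E 1) (E 2) -
      cyclic_sum (norden_trace_part 2 (F_tensor (G49 p) 2)) (E 1) (E 1) (E 2) = p + 2"
    by (simp add: F_eval norden_trace_part_def lee_form_eq field_simps)
  moreover have "p + 2 \<noteq> 0"
    using assms by simp
  ultimately show "cyclic_sum (F_tensor (G49 p) 2) (E 1) (E 1) (E 2) \<noteq>
      cyclic_sum (norden_trace_part 2 (F_tensor (G49 p) 2)) (E 1) (E 1) (E 2)"
    by (metis diff_self)
qed

lemma G49_J2_not_W23:
  assumes "-1 < p"
  shows "F_tensor (G49 p) 2 \<notin> direct_sum_class 2 {2, 3}"
proof (rule norden_not_W23I[OF Norden_index(1), where z = "E 2"])
  have "lee_form (F_tensor (G49 p) 2) (E 2) = 2 * (p + 2)"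
    by (simp add: F_eval lee_form_eq field_simps)
  then show "lee_form (F_tensor (G49 p) 2) (E 2) \<noteq> 0"
    using assms by simp
qed

lemma G49_J3_not_W13:
  assumes "-1 < p"
  shows "F_tensor (G49 p) 3 \<notin> direct_sum_class 3 {1, 3}"
proof (rule norden_not_W13I[OF Norden_index(2), where x = "E 1" and y = "E 1" and z = "E 1"])
  have "cyclic_sum (F_tensor (G49 p) 3) (E 1) (E 1) (E 1) -
      cyclic_sum (norden_trace_part 3 (F_tensor (G49 p) 3)) (E 1) (E 1) (E 1) = - 3/2 * (p + 1)"
    by (simp add: F_eval norden_trace_part_def lee_form_eq field_simps)
  moreover have "- 3/2 * (p + 1) \<noteq> 0"
    using assms by simp
  ultimately show "cyclic_sum (F_tensor (G49 p) 3) (E 1) (E 1) (E 1) \<noteq>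
      cyclic_sum (norden_trace_part 3 (F_tensor (G49 p) 3)) (E 1) (E 1) (E 1)"
    by (metis diff_self)
qed

lemma G49_J3_not_W23:
  assumes "-1 < p"
  shows "F_tensor (G49 p) 3 \<notin> direct_sum_class 3 {2, 3}"
proof (rule norden_not_W23I[OF Norden_index(2), where z = "E 1"])
  have "lee_form (F_tensor (G49 p) 3) (E 1) = - 3 * (p + 1)"
    by (simp add: F_eval lee_form_eq field_simps)
  then show "lee_form (F_tensor (G49 p) 3) (E 1) \<noteq> 0"
    using assms by simp
qed

lemmas special_classes =
  G42_J1_W4 G45_J1_W2 G45_J1_W4 G45_J2_W1 G45_J2_W2
  G45_J2_W12 G45_J2_W23 G45_J3_W2 G45_J3_W12 G45_J3_W23
  G46_J3_W12 G47_J1_W4 G48_J3_W3 G49_J1_W4 G49_J2_W12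
  G49_J3_W12 G411_J3_W12 G412_J1_W4

lemmas excluded_classes =
  G42_J1_not_W2 G42_J2_not_W12 G42_J2_not_W13 G42_J2_not_W23
  G42_J3_not_W12 G42_J3_not_W13 G42_J3_not_W23 G46_J1_not_W2
  G46_J1_not_W4 G46_J2_not_W12 G46_J2_not_W13 G46_J2_not_W23
  G46_J3_not_W13 G46_J3_not_W23 G411_J1_not_W2 G411_J1_not_W4
  G411_J2_not_W12 G411_J2_not_W13 G411_J2_not_W23 G411_J3_not_W13
  G411_J3_not_W23 G49_J1_not_W2 G49_J2_not_W13 G49_J2_not_W23
  G49_J3_not_W13 G49_J3_not_W23 G45_J1_not_W0 G45_J2_not_W3
  G45_J2_not_W13 G45_J3_not_W3 G45_J3_not_W13
  hermitian_not_W0 norden_not_W0 norden_not_W1_W3 norden_not_W2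

section \<open>The classification\<close>

theorem theorem4p1:
  fixes l :: lie_alg
    and A :: "('p::{t2_space,second_countable_topology}, real^4) atlas"
    and mul :: "'p \<Rightarrow> 'p \<Rightarrow> 'p" and one :: 'p and inver :: "'p \<Rightarrow> 'p"
    and e :: "4 \<Rightarrow> 'p vf"
    and J :: "3 \<Rightarrow> 'p vf \<Rightarrow> 'p vf"
    and g :: "'p vf \<Rightarrow> 'p vf \<Rightarrow> 'p \<Rightarrow> real"
    and N :: "'p vf \<Rightarrow> 'p vf \<Rightarrow> 'p vf"
  assumes "hypercomplex_HN_lie_group l A mul one inver e J g N"
  shows
    "(l = G41 \<longrightarrow> in_classes e J g N {2,4} {1,2,3} {1,2,3}) \<and>
     (\<forall>m. l = G42 m \<and> m = 1 \<longrightarrow> in_classes e J g N {4} {1,2,3} {1,2,3}) \<and>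
     (\<forall>m. l = G42 m \<and> m \<noteq> 0 \<and> m \<noteq> 1 \<longrightarrow> in_classes e J g N {2,4} {1,2,3} {1,2,3}) \<and>
     (l = G43 \<longrightarrow> in_classes e J g N {2,4} {1,2,3} {1,2,3}) \<and>
     (l = G44 \<longrightarrow> in_classes e J g N {2,4} {1,2,3} {1,2,3}) \<and>
     (\<forall>a1 a2. l = G45 a1 a2 \<and> a1 \<noteq> 0 \<and> a2 \<noteq> 0 \<longrightarrow>
       (a1 = -1 \<and> a2 = 1 \<longrightarrow> in_classes e J g N {2} {2} {1,2,3}) \<and>
       (a1 = -1 \<and> a2 = -1 \<longrightarrow> in_classes e J g N {2} {1,2,3} {2}) \<and>
       (a1 = -1 \<and> a2 \<noteq> 1 \<and> a2 \<noteq> -1 \<longrightarrow> in_classes e J g N {2} {1,2,3} {1,2,3}) \<and>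
       (a1 = 1 \<and> a2 = 1 \<longrightarrow> in_classes e J g N {4} {1} {1,2}) \<and>
       (a1 = 1 \<and> a2 = -3 \<longrightarrow> in_classes e J g N {4} {2,3} {2,3}) \<and>
       (a1 = 1 \<and> a2 \<notin> {-3, 1} \<longrightarrow> in_classes e J g N {4} {1,2,3} {1,2,3}) \<and>
       (a1 \<noteq> 1 \<and> a1 \<noteq> -1 \<and> a2 = 1 \<longrightarrow> in_classes e J g N {2,4} {1,2} {1,2,3}) \<and>
       (a1 = -1/3 \<and> a2 = -1/3 \<longrightarrow> in_classes e J g N {2,4} {2,3} {1,2}) \<and>
       (a1 = -1/2 * (a2 + 1) \<and> a2 \<notin> {-3, -1/3, 1} \<longrightarrow> in_classes e J g N {2,4} {2,3} {1,2,3}) \<and>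
       (a1 = a2 \<and> a2 \<notin> {1, -1, -1/3} \<longrightarrow> in_classes e J g N {2,4} {1,2,3} {1,2}) \<and>
       (a1 = - a2 - 2 \<and> a2 \<notin> {-3, -1} \<longrightarrow> in_classes e J g N {2,4} {1,2,3} {2,3}) \<and>
       in_classes e J g N {2,4} {1,2,3} {1,2,3}) \<and>
     (\<forall>b1 b2. l = G46 b1 b2 \<and> b1 \<noteq> 0 \<and> b2 \<ge> 0 \<longrightarrow> in_classes e J g N {2,4} {1,2,3} {1,2}) \<and>
     (l = G47 \<longrightarrow> in_classes e J g N {4} {1,2,3} {1,2,3}) \<and>
     (l = G48 \<longrightarrow> in_classes e J g N {2,4} {1,2,3} {3}) \<and>
     (\<forall>p. l = G49 p \<and> p = 1 \<longrightarrow> in_classes e J g N {4} {1,2} {1,2}) \<and>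
     (\<forall>p. l = G49 p \<and> -1 < p \<and> p < 1 \<longrightarrow> in_classes e J g N {2,4} {1,2} {1,2,3}) \<and>
     (l = G410 \<longrightarrow> in_classes e J g N {2,4} {1,2,3} {1,2,3}) \<and>
     (\<forall>q. l = G411 q \<and> q > 0 \<longrightarrow> in_classes e J g N {2,4} {1,2,3} {1,2}) \<and>
     (l = G412 \<longrightarrow> in_classes e J g N {4} {1,2,3} {1,2,3}) \<and>
     (\<forall>a1 a2. l = G45 a1 a2 \<and> a1 \<noteq> 0 \<and> a2 \<noteq> 0 \<longrightarrow>
       in_none e J g N {{0}} {{0}, {3}} {{0}, {3}} \<and>
       ((a1, a2) \<noteq> (1, 1) \<longrightarrow> in_none e J g N {} {{1,3}} {{1}, {1,3}})) \<and>
     (\<forall>b1 b2. l = G46 b1 b2 \<and> b1 \<noteq> 0 \<and> b2 \<ge> 0 \<longrightarrow>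
       in_none e J g N {{0}, {2}, {4}}
         {{0}, {1}, {2}, {3}, {1,2}, {1,3}, {2,3}} {{0}, {1}, {2}}) \<and>
     (\<forall>m. l = G42 m \<and> m \<noteq> 0 \<longrightarrow>
       in_none e J g N {{0}, {2}}
         {{0}, {1}, {2}, {3}, {1,2}, {1,3}, {2,3}}
         {{0}, {1}, {2}, {3}, {1,2}, {1,3}, {2,3}}) \<and>
     (\<forall>p. l = G49 p \<and> -1 < p \<and> p \<le> 1 \<longrightarrow>
       in_none e J g N {{0}, {2}} {{0}, {1}, {2}}
         {{0}, {1}, {2}, {3}, {1,3}, {2,3}}) \<and>
     (\<forall>q. l = G411 q \<and> q > 0 \<longrightarrow>
       in_none e J g N {{0}, {2}, {4}}
         {{0}, {1}, {2}, {3}, {1,2}, {1,3}, {2,3}} {{0}, {1}, {2}})"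
proof -
  interpret hypercomplex_HN_lie_group l A mul one inver e J g N
    by (rule assms)
  show ?thesis
    unfolding in_classes_def in_none_def in_class_iff
    \<comment> \<open>Keeping the index \<open>1\<close> from becoming \<open>Suc 0\<close> lets the index sets match the collected facts literally.\<close>
    by (intro conjI allI impI; (elim conjE)?;
        simp del: One_nat_def add: generic_classes special_classes excluded_classes)
qed

end
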